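(* \textsc{MaxCut} is polynomial-time Turing reducible to \textsc{MaxAvgCutOpt}; that is, there is a polynomial-time algorithm that solves \textsc{MaxCut} using an oracle for \textsc{MaxAvgCutOpt}. Here \textsc{MaxCut} is the problem: given an undirected, unweighted, connected graph $G$ and an integer $k$, output YES if there is a partition $(A,B)$ of $V(G)$ with $|\delta(A)| \ge k$, and NO otherwise. \textsc{MaxAvgCutOpt} is the problem: given a connected graph $G$ with edge weights $w_e \in \{-1,1\}$ for all edges $e$, output a nontrivial partition $(A,B)$ of $V(G)$ such that for all nontrivial partitions $(A',B')$ of $V(G)$, \[\frac{\sum_{e\in\delta(A)} w_e}{|\delta(A)|} \ge \frac{\sum_{e\in\delta(A')} w_e}{|\delta(A')|}.\]
   Context: For $A \subseteq V(G)$, $\delta(A)$ denotes the set of edges of $G$ with exactly one endpoint in $A$. A partition $(A,B)$ of $V(G)$ is nontrivial if both $A$ and $B$ are nonempty. *)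

theory Defs
  imports Complex_Main "HOL-Computational_Algebra.Polynomial"
begin

section \<open>Oracle programs and their running time\<close>

text \<open>
  The machine model is that of a multi-tape oracle Turing machine with structured control.
  Each register is a stack of bits, a program uses finitely many of them, and every command other
  than copying and querying does a constant amount of work on one end of a single register.
  Copying is charged the length of the copied string, and an oracle query the length of both the
  query and the answer.  Hence polynomial time here agrees with polynomial time on oracle Turing
  machines.
\<close>

type_synonym reg = nat
type_synonym state = "reg \<Rightarrow> bool list"
type_synonym oracle_fun = "bool list \<Rightarrow> bool list"

datatype test = Nonempty reg | Top reg

datatype com =
    Skip
  | Push reg bool
  | Pop reg
  | Copy reg reg      \<comment> \<open>source, target\<close>
  | Query reg reg     \<comment> \<open>register holding the query, register receiving the answer\<close>
  | Seq com com
  | Cond test com com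
  | While test com

fun holds :: "test \<Rightarrow> state \<Rightarrow> bool" where
  "holds (Nonempty r) s \<longleftrightarrow> s r \<noteq> []"
| "holds (Top r) s \<longleftrightarrow> s r \<noteq> [] \<and> hd (s r)"

text \<open>\<open>exec f c s t s'\<close>: with oracle \<open>f\<close>, the program \<open>c\<close> started in state \<open>s\<close> halts in
  state \<open>s'\<close> after \<open>t\<close> time units.\<close>

inductive exec :: "oracle_fun \<Rightarrow> com \<Rightarrow> state \<Rightarrow> nat \<Rightarrow> state \<Rightarrow> bool" for f :: oracle_fun where
  Skip: "exec f Skip s 1 s"
| Push: "exec f (Push r b) s 1 (s(r := b # s r))"
| Pop: "exec f (Pop r) s 1 (s(r := tl (s r)))"
| Copy: "exec f (Copy r r') s (1 + length (s r)) (s(r' := s r))"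
| Query: "exec f (Query r r') s (1 + length (s r) + length (f (s r))) (s(r' := f (s r)))"
| Seq: "exec f c1 s t1 s1 \<Longrightarrow> exec f c2 s1 t2 s2 \<Longrightarrow> exec f (Seq c1 c2) s (t1 + t2) s2"
| CondTrue: "holds b s \<Longrightarrow> exec f c1 s t s' \<Longrightarrow> exec f (Cond b c1 c2) s (1 + t) s'"
| CondFalse: "\<not> holds b s \<Longrightarrow> exec f c2 s t s' \<Longrightarrow> exec f (Cond b c1 c2) s (1 + t) s'"
| WhileFalse: "\<not> holds b s \<Longrightarrow> exec f (While b c) s 1 s"
| WhileTrue: "holds b s \<Longrightarrow> exec f c s t1 s1 \<Longrightarrow> exec f (While b c) s1 t2 s2
    \<Longrightarrow> exec f (While b c) s (1 + t1 + t2) s2"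

inductive_cases exec_SkipE: "exec f Skip s t s'"
inductive_cases exec_PushE: "exec f (Push r b) s t s'"
inductive_cases exec_PopE: "exec f (Pop r) s t s'"
inductive_cases exec_CopyE: "exec f (Copy r r') s t s'"
inductive_cases exec_QueryE: "exec f (Query r r') s t s'"
inductive_cases exec_SeqE: "exec f (Seq c1 c2) s t s'"
inductive_cases exec_CondE: "exec f (Cond b c1 c2) s t s'"
inductive_cases exec_WhileE: "exec f (While b c) s t s'"

lemma exec_deterministic:
  "exec f c s t s' \<Longrightarrow> exec f c s u u' \<Longrightarrow> t = u \<and> s' = u'"
proof (induction arbitrary: u u' rule: exec.induct)
  case (Seq c1 s t1 s1 c2 t2 s2)
  from Seq.prems obtain v1 v w where "exec f c1 s v1 w" "exec f c2 w v u'" "u = v1 + v"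
    by (auto elim: exec_SeqE)
  with Seq.IH show ?case by blast
next
  case (WhileTrue b s c t1 s1 t2 s2)
  from WhileTrue.prems WhileTrue.hyps(1) obtain v1 v w
    where "exec f c s v1 w" "exec f (While b c) w v u'" "u = 1 + v1 + v"
    by (auto elim: exec_WhileE)
  with WhileTrue.IH show ?case by blast
next
  case (CondTrue b s c1 t s' c2)
  from CondTrue.prems CondTrue.hyps(1) obtain v where "exec f c1 s v u'" "u = 1 + v"
    by (auto elim: exec_CondE)
  with CondTrue.IH show ?case by blast
next
  case (CondFalse b s c2 t s' c1)
  from CondFalse.prems CondFalse.hyps(1) obtain v where "exec f c2 s v u'" "u = 1 + v"
    by (auto elim: exec_CondE)
  with CondFalse.IH show ?case by blast
qed (auto elim: exec_SkipE exec_PushE exec_PopE exec_CopyE exec_QueryE exec_WhileE)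

definition input_state :: "bool list \<Rightarrow> state" where
  "input_state x = (\<lambda>r. if r = 0 then x else [])"

definition result :: "state \<Rightarrow> bool list" where
  "result s = s 1"


section \<open>Problems and polynomial-time Turing reductions\<close>

text \<open>\<open>P x y\<close>: the string \<open>x\<close> encodes an instance and \<open>y\<close> encodes a correct output for it.
  A decision problem is a problem whose outputs are \<open>[True]\<close> (YES) and \<open>[False]\<close> (NO).\<close>

type_synonym problem = "bool list \<Rightarrow> bool list \<Rightarrow> bool"

text \<open>An oracle is unconstrained on strings that are not instances, and on instances that have
  no correct output at all: a one-vertex graph has no nontrivial partition, so without the
  latter proviso there would be no oracle for the problem \<open>MaxAvgCutOpt\<close> below.\<close>

definition oracle_for :: "problem \<Rightarrow> oracle_fun \<Rightarrow> bool" where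
  "oracle_for P f \<longleftrightarrow> (\<forall>x. (\<exists>y. P x y) \<longrightarrow> P x (f x))"

lemma oracle_exists: "\<exists>f. oracle_for P f"
  unfolding oracle_for_def by (rule exI[of _ "\<lambda>x. SOME y. P x y"]) (blast intro: someI_ex)

definition poly_time_turing_reducible :: "problem \<Rightarrow> problem \<Rightarrow> bool" where
  "poly_time_turing_reducible P Q \<longleftrightarrow>
    (\<exists>(c :: com) (p :: nat poly). \<forall>f. oracle_for Q f \<longrightarrow>
      (\<forall>x. (\<exists>y. P x y) \<longrightarrow>
        (\<exists>t s. exec f c (input_state x) t s \<and> t \<le> poly p (length x) \<and> P x (result s))))"


section \<open>Graphs and cuts\<close>

text \<open>A finite simple graph is given by its vertex set and its set of edges, each edge being the
  set of its two endpoints.\<close>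

definition graph :: "'a set \<Rightarrow> 'a set set \<Rightarrow> bool" where
  "graph V E \<longleftrightarrow> finite V \<and> (\<forall>e\<in>E. \<exists>u\<in>V. \<exists>v\<in>V. u \<noteq> v \<and> e = {u, v})"

definition connected_graph :: "'a set \<Rightarrow> 'a set set \<Rightarrow> bool" where
  "connected_graph V E \<longleftrightarrow> graph V E \<and> V \<noteq> {} \<and>
    (\<forall>u\<in>V. \<forall>v\<in>V. (u, v) \<in> {(x, y). {x, y} \<in> E}\<^sup>*)"

definition cut :: "'a set set \<Rightarrow> 'a set \<Rightarrow> 'a set set" where
  "cut E A = {e \<in> E. card (e \<inter> A) = 1}"

definition vertex_partition :: "'a set \<Rightarrow> 'a set \<Rightarrow> 'a set \<Rightarrow> bool" where
  "vertex_partition V A B \<longleftrightarrow> A \<union> B = V \<and> A \<inter> B = {}"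

definition nontrivial_partition :: "'a set \<Rightarrow> 'a set \<Rightarrow> 'a set \<Rightarrow> bool" where
  "nontrivial_partition V A B \<longleftrightarrow> vertex_partition V A B \<and> A \<noteq> {} \<and> B \<noteq> {}"

definition avg_cut :: "'a set set \<Rightarrow> ('a set \<Rightarrow> int) \<Rightarrow> 'a set \<Rightarrow> real" where
  "avg_cut E w A = real_of_int (\<Sum>e\<in>cut E A. w e) / real (card (cut E A))"


section \<open>Encodings\<close>

text \<open>Instances are graphs with vertex set \<open>{..<n}\<close>.  The encoding is \<open>n\<close> in unary, ended by
  \<open>False\<close>, followed by the adjacency matrix in row-major order.  An entry of the matrix of a
  weighted graph takes two bits: whether there is an edge, and whether its weight is \<open>1\<close>.\<close>

definition enc_graph :: "nat \<Rightarrow> nat set set \<Rightarrow> bool list" where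
  "enc_graph n E = replicate n True @ [False] @
    concat (map (\<lambda>i. map (\<lambda>j. {i, j} \<in> E) [0..<n]) [0..<n])"

definition enc_weighted_graph :: "nat \<Rightarrow> nat set set \<Rightarrow> (nat set \<Rightarrow> int) \<Rightarrow> bool list" where
  "enc_weighted_graph n E w = replicate n True @ [False] @
    concat (map (\<lambda>i. concat (map (\<lambda>j. [{i, j} \<in> E, {i, j} \<in> E \<and> w {i, j} = 1]) [0..<n])) [0..<n])"

text \<open>Binary, least significant bit first; an integer is its sign followed by its absolute value.\<close>

fun enc_nat :: "nat \<Rightarrow> bool list" where
  "enc_nat n = (if n = 0 then [] else odd n # enc_nat (n div 2))"

declare enc_nat.simps [simp del]

definition enc_int :: "int \<Rightarrow> bool list" where
  "enc_int k = (k < 0) # enc_nat (nat \<bar>k\<bar>)"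

text \<open>A partition \<open>(A, B)\<close> of \<open>{..<n}\<close> is encoded by the characteristic vector of \<open>A\<close>.\<close>

definition enc_partition :: "nat \<Rightarrow> nat set \<Rightarrow> nat set \<Rightarrow> bool list" where
  "enc_partition n A B = map (\<lambda>i. i \<in> A) [0..<n]"


section \<open>The two problems\<close>

definition MaxCut :: problem where
  "MaxCut x y \<longleftrightarrow> (\<exists>n E k.
    connected_graph {..<n} E \<and>
    x = enc_graph n E @ enc_int k \<and>
    y = [\<exists>A B. vertex_partition {..<n} A B \<and> int (card (cut E A)) \<ge> k])"

definition MaxAvgCutOpt :: problem where
  "MaxAvgCutOpt x y \<longleftrightarrow> (\<exists>n E w A B.
    connected_graph {..<n} E \<and> (\<forall>e\<in>E. w e \<in> {-1, 1}) \<and>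
    x = enc_weighted_graph n E w \<and>
    y = enc_partition n A B \<and>
    nontrivial_partition {..<n} A B \<and>
    (\<forall>A' B'. nontrivial_partition {..<n} A' B' \<longrightarrow> avg_cut E w A \<ge> avg_cut E w A'))"


section \<open>The encodings are unambiguous and the problems are well posed\<close>

lemma replicate_False_append_inj:
  assumes "replicate n True @ False # xs = replicate m True @ False # ys"
  shows "n = m \<and> xs = ys"
  using assms
proof (induction n arbitrary: m)
  case 0
  then show ?case by (cases m) auto
next
  case (Suc n)
  then show ?case by (cases m) auto
qed

lemma concat_map_append_inj:
  assumes "concat (map f xs) @ us = concat (map g xs) @ vs"
    and "\<And>i. i \<in> set xs \<Longrightarrow> length (f i) = length (g i)"
  shows "(\<forall>i\<in>set xs. f i = g i) \<and> us = vs"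
  using assms by (induction xs) auto

lemma graph_eqI:
  assumes "graph {..<n} E" "graph {..<n} E'"
    and "\<And>i j. i < n \<Longrightarrow> j < n \<Longrightarrow> {i, j} \<in> E \<longleftrightarrow> {i, j} \<in> E'"
  shows "E = E'"
proof (rule set_eqI)
  fix e show "e \<in> E \<longleftrightarrow> e \<in> E'"
    using assms unfolding graph_def by (auto 4 4)
qed

lemma enc_graph_inj:
  assumes "graph {..<n} E" "graph {..<n'} E'" "enc_graph n E @ z = enc_graph n' E' @ z'"
  shows "n = n' \<and> E = E' \<and> z = z'"
proof -
  let ?r = "\<lambda>E n. concat (map (\<lambda>i. map (\<lambda>j. {i, j} \<in> E) [0..<n]) [0..<n])"
  have *: "n = n' \<and> ?r E n @ z = ?r E' n' @ z'"
    by (rule replicate_False_append_inj) (use assms(3) in \<open>simp add: enc_graph_def\<close>)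
  then have "?r E n @ z = ?r E' n @ z'" by (elim conjE) (simp only:)
  from concat_map_append_inj[OF this]
  have "(\<forall>i<n. \<forall>j<n. {i, j} \<in> E \<longleftrightarrow> {i, j} \<in> E') \<and> z = z'" by simp
  with * assms(1,2) graph_eqI[of n E E'] show ?thesis by blast
qed

lemma enc_weighted_graph_inj:
  assumes "graph {..<n} E" "graph {..<n'} E'"
    and "\<forall>e\<in>E. w e \<in> {-1, 1}" "\<forall>e\<in>E'. w' e \<in> {-1, 1}"
    and "enc_weighted_graph n E w = enc_weighted_graph n' E' w'"
  shows "n = n' \<and> E = E' \<and> (\<forall>e\<in>E. w e = w' e)"
proof -
  let ?b = "\<lambda>E w i j. [{i, j} \<in> E, {i, j} \<in> E \<and> w {i, j} = (1::int)]"
  let ?q = "\<lambda>E w n i. concat (map (?b E w i) [0..<n])"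
  let ?r = "\<lambda>E w n. concat (map (?q E w n) [0..<n])"
  have *: "n = n' \<and> ?r E w n = ?r E' w' n'"
    by (rule replicate_False_append_inj) (use assms(5) in \<open>simp add: enc_weighted_graph_def\<close>)
  then have "?r E w n @ [] = ?r E' w' n @ []" by (elim conjE) (simp only:)
  from concat_map_append_inj[OF this]
  have rows: "?q E w n i @ [] = ?q E' w' n i @ []" if "i < n" for i
    using that by (simp add: length_concat comp_def)
  have ent: "?b E w i j = ?b E' w' i j" if "i < n" "j < n" for i j
    using concat_map_append_inj[OF rows[OF that(1)]] that(2) by (auto simp: Ball_def)
  have E: "E = E'"
    by (rule graph_eqI[of n]) (use assms(1,2) * ent in auto)
  moreover have "w e = w' e" if e: "e \<in> E" for e
  proof -
    obtain i j where "i < n" "j < n" "e = {i, j}"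
      using assms(1) e unfolding graph_def by auto
    with ent[of i j] e E have "w e = 1 \<longleftrightarrow> w' e = 1" by auto
    with assms(3,4) e E show ?thesis by force
  qed
  ultimately show ?thesis using * by blast
qed

lemma enc_nat_inj: "enc_nat m = enc_nat n \<Longrightarrow> m = n"
proof (induction m arbitrary: n rule: less_induct)
  case (less m)
  show ?case
  proof (cases "m = 0 \<or> n = 0")
    case True
    then show ?thesis using less.prems
      by (auto simp: enc_nat.simps[of m] enc_nat.simps[of n] split: if_splits)
  next
    case False
    then have "odd m = odd n" "enc_nat (m div 2) = enc_nat (n div 2)"
      using less.prems by (simp_all add: enc_nat.simps[of m] enc_nat.simps[of n])
    moreover have "m div 2 = n div 2"
      by (rule less.IH) (use False calculation in auto)
    ultimately show ?thesis
      by (metis odd_two_times_div_two_succ dvd_mult_div_cancel)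
  qed
qed

lemma enc_int_inj: "enc_int k = enc_int l \<Longrightarrow> k = l"
  unfolding enc_int_def by (auto dest!: enc_nat_inj)

lemma MaxCut_unique:
  assumes "MaxCut x y" "MaxCut x y'"
  shows "y = y'"
proof -
  obtain n E k where 1: "graph {..<n} E" "x = enc_graph n E @ enc_int k"
      "y = [\<exists>A B. vertex_partition {..<n} A B \<and> int (card (cut E A)) \<ge> k]"
    using assms(1) unfolding MaxCut_def connected_graph_def by blast
  obtain n' E' k' where 2: "graph {..<n'} E'" "x = enc_graph n' E' @ enc_int k'"
      "y' = [\<exists>A B. vertex_partition {..<n'} A B \<and> int (card (cut E' A)) \<ge> k']"
    using assms(2) unfolding MaxCut_def connected_graph_def by blast
  have "n = n' \<and> E = E' \<and> enc_int k = enc_int k'"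
    by (rule enc_graph_inj[OF 1(1) 2(1)]) (use 1(2) 2(2) in simp)
  then show ?thesis using enc_int_inj[of k k'] 1(3) 2(3) by simp
qed

lemma MaxAvgCutOpt_solvable:
  assumes "connected_graph {..<n} E" "\<forall>e\<in>E. w e \<in> {-1, 1}" "n \<ge> 2"
  shows "\<exists>y. MaxAvgCutOpt (enc_weighted_graph n E w) y"
proof -
  let ?S = "{A. \<exists>B. nontrivial_partition {..<n} A B}"
  have "?S \<subseteq> Pow {..<n}"
    unfolding nontrivial_partition_def vertex_partition_def by blast
  then have fin: "finite (avg_cut E w ` ?S)" by (simp add: finite_subset)
  have "nontrivial_partition {..<n} {0} {1..<n}"
    using assms(3) unfolding nontrivial_partition_def vertex_partition_def by auto
  then have ne: "avg_cut E w ` ?S \<noteq> {}" by blast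
  obtain A where A: "A \<in> ?S" "avg_cut E w A = Max (avg_cut E w ` ?S)"
    using Max_in[OF fin ne] by force
  then obtain B where "nontrivial_partition {..<n} A B" by blast
  moreover have "avg_cut E w A' \<le> avg_cut E w A" if "nontrivial_partition {..<n} A' B'" for A' B'
    unfolding A(2) by (rule Max_ge[OF fin]) (use that in auto)
  ultimately show ?thesis using assms unfolding MaxAvgCutOpt_def by blast
qed

end

theory Submission
  imports Defs
begin

text \<open>
  To a graph on \<open>V = {..<n}\<close> add two sets \<open>L\<close> and \<open>R\<close> of \<open>m\<close> vertices each, with \<open>2 * m > n\<^sup>2\<close>.  Join \<open>L\<close>
  completely to \<open>R\<close> by edges of weight \<open>1\<close> and \<open>V\<close> completely to \<open>L \<union> R\<close> by edges of weight \<open>-1\<close>; the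
  original edges get weight \<open>1\<close>.  Maximising the average weight of a cut means minimising the ratio
  of its numbers of negative and positive edges.  A cut that separates \<open>L\<close> from \<open>R\<close> has exactly
  \<open>n * m\<close> negative edges, wherever the vertices of \<open>V\<close> go, and \<open>m\<^sup>2 + c\<close> positive ones, where \<open>c\<close> is the
  size of its trace in the original graph.  Since \<open>m\<close> is large, no other cut has a smaller ratio,
  so the trace on \<open>V\<close> of every optimal cut is a maximum cut.

  One query therefore suffices: its answer is restricted to \<open>V\<close>, the edges cut are counted and the
  count is compared with \<open>k\<close>.  The length of the input serves as \<open>m\<close>.
\<close>

section \<open>Execution with a time bound\<close>

text \<open>An upper bound in place of the exact time lets branches of different cost share one
  bound and keeps the bounds of nested loops in closed form.\<close>

definition runs :: "oracle_fun \<Rightarrow> com \<Rightarrow> state \<Rightarrow> nat \<Rightarrow> state \<Rightarrow> bool" where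
  "runs f c s T s' \<longleftrightarrow> (\<exists>t\<le>T. exec f c s t s')"

text \<open>Composing the rules below yields nested function updates and raw sums; this rule
  exchanges them for the intended final state and bound.\<close>

lemma runs_weaken: "runs f c s T s' \<Longrightarrow> T \<le> T' \<Longrightarrow> s' = s'' \<Longrightarrow> runs f c s T' s''"
  unfolding runs_def by (meson le_trans)

lemma runs_Skip: "runs f Skip s 1 s"
  unfolding runs_def by (blast intro: exec.Skip)

lemma runs_Push: "runs f (Push r b) s 1 (s(r := b # s r))"
  unfolding runs_def by (blast intro: exec.Push)

lemma runs_Pop: "runs f (Pop r) s 1 (s(r := tl (s r)))"
  unfolding runs_def by (blast intro: exec.Pop)

lemma runs_Copy: "runs f (Copy r r') s (1 + length (s r)) (s(r' := s r))"
  unfolding runs_def by (blast intro: exec.Copy)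

lemma runs_Query: "runs f (Query r r') s (1 + length (s r) + length (f (s r))) (s(r' := f (s r)))"
  unfolding runs_def by (blast intro: exec.Query)

lemma runs_Seq:
  "runs f c1 s T1 s1 \<Longrightarrow> runs f c2 s1 T2 s2 \<Longrightarrow> runs f (Seq c1 c2) s (T1 + T2) s2"
  unfolding runs_def by (meson add_mono exec.Seq)

lemma runs_Cond:
  assumes "holds b s \<Longrightarrow> runs f c1 s T s'" "\<not> holds b s \<Longrightarrow> runs f c2 s T s'"
  shows "runs f (Cond b c1 c2) s (1 + T) s'"
  using assms unfolding runs_def
  by (cases "holds b s") (meson add_left_mono exec.CondTrue exec.CondFalse)+

lemma runs_While_done: "\<not> holds b s \<Longrightarrow> runs f (While b c) s 1 s"
  unfolding runs_def by (blast intro: exec.WhileFalse)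

lemma runs_While_step:
  "holds b s \<Longrightarrow> runs f c s T1 s1 \<Longrightarrow> runs f (While b c) s1 T2 s2
    \<Longrightarrow> runs f (While b c) s (1 + T1 + T2) s2"
  unfolding runs_def by (meson add_mono add_left_mono exec.WhileTrue)

text \<open>The family \<open>S\<close> plays the part of an invariant: it fixes the state before
  every round, so the number of rounds is known to be \<open>m\<close>. The leading 1 in the bound
  pays for the last, failing test.\<close>

lemma runs_While:
  assumes "\<And>i. i < m \<Longrightarrow> holds b (S i) \<and> runs f c (S i) T (S (Suc i))"
    and "\<not> holds b (S m)"
  shows "runs f (While b c) (S 0) (1 + m * (T + 1)) (S m)"
  using assms
proof (induction m arbitrary: S)
  case 0
  then show ?case by (simp add: runs_While_done[simplified])
next
  case (Suc m)
  have "runs f (While b c) (S (Suc 0)) (1 + m * (T + 1)) (S (Suc m))"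
    by (rule Suc.IH[of "\<lambda>i. S (Suc i)"]) (use Suc.prems in auto)
  from runs_While_step[OF _ _ this] Suc.prems(1)[of 0]
  have "runs f (While b c) (S 0) (1 + T + (1 + m * (T + 1))) (S (Suc m))" by simp
  then show ?case by (rule runs_weaken) (auto simp: algebra_simps)
qed

text \<open>The loop consumes a copy, so the register whose length gives the number of rounds
  survives and can drive further loops, also nested ones with another counter.\<close>

definition For :: "reg \<Rightarrow> reg \<Rightarrow> com \<Rightarrow> com" where
  "For r tmp c = Seq (Copy r tmp) (While (Nonempty tmp) (Seq (Pop tmp) c))"

text \<open>The loop body sees the counter \<open>tmp\<close> with an arbitrary content, which it has to preserve.\<close>

lemma runs_For:
  assumes "length (s r) = m" "m \<le> B" "S 0 = s"
    and "\<And>i v. i < m \<Longrightarrow> runs f c ((S i)(tmp := v)) T ((S (Suc i))(tmp := v))"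
  shows "runs f (For r tmp c) s (2 + B + B * (T + 2)) ((S m)(tmp := []))"
proof -
  let ?S = "\<lambda>i. (S i)(tmp := drop i (s r))"
  have "runs f (While (Nonempty tmp) (Seq (Pop tmp) c)) (?S 0) (1 + m * ((1 + T) + 1)) (?S m)"
  proof (rule runs_While)
    fix i assume i: "i < m"
    have "runs f (Seq (Pop tmp) c) (?S i) (1 + T) (?S (Suc i))"
    proof (rule runs_Seq)
      show "runs f (Pop tmp) (?S i) 1 ((S i)(tmp := drop (Suc i) (s r)))"
        by (rule runs_weaken[OF runs_Pop]) (simp_all add: drop_Suc tl_drop)
    qed (rule assms(4)[OF i])
    with i assms(1) show "holds (Nonempty tmp) (?S i) \<and> runs f (Seq (Pop tmp) c) (?S i) (1 + T) (?S (Suc i))"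
      by simp
  qed (use assms(1) in simp)
  then have w: "runs f (While (Nonempty tmp) (Seq (Pop tmp) c)) (s(tmp := s r)) (1 + m * ((1 + T) + 1)) (?S m)"
    by (simp add: assms(3))
  have "m * (1 + T + 1) \<le> B * (T + 2)"
    using assms(2) by (intro mult_le_mono) auto
  then show ?thesis
    unfolding For_def
    by (intro runs_weaken[OF runs_Seq[OF runs_Copy w]]) (use assms(1,2) in auto)
qed

text \<open>Output is written by pushing, so that it accumulates in reverse.\<close>

fun emit :: "reg \<Rightarrow> bool list \<Rightarrow> com" where
  "emit q [] = Skip"
| "emit q (b # bs) = Seq (Push q b) (emit q bs)"

lemma runs_emit: "runs f (emit q bs) s (length bs + 1) (s(q := rev bs @ s q))"
proof (induction bs arbitrary: s)
  case Nil
  show ?case by (simp only: emit.simps, rule runs_weaken[OF runs_Skip]) auto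
next
  case (Cons b bs)
  show ?case
    by (simp only: emit.simps, rule runs_weaken[OF runs_Seq[OF runs_Push Cons]]) auto
qed

lemma runs_For_emit:
  assumes "length (s r) = m" "m \<le> B" "tmp \<noteq> q"
  shows "runs f (For r tmp (emit q bs)) s (2 + B + B * (length bs + 3))
    (s(tmp := [], q := rev (concat (replicate m bs)) @ s q))"
proof -
  let ?S = "\<lambda>i. s(q := rev (concat (replicate i bs)) @ s q)"
  have "runs f (For r tmp (emit q bs)) s (2 + B + B * ((length bs + 1) + 2)) ((?S m)(tmp := []))"
  proof (rule runs_For[where s = s and r = r and S = ?S])
    fix i v
    \<comment> \<open>\<open>replicate\<close> unfolds at the front, whereas the loop adds its block
      at the end; all blocks being equal, both agree.\<close>
    have "concat (replicate (Suc i) bs) = concat (replicate i bs) @ bs"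
      by (induction i) auto
    then show "runs f (emit q bs) ((?S i)(tmp := v)) (length bs + 1) ((?S (Suc i))(tmp := v))"
      using assms(3) by (intro runs_weaken[OF runs_emit]) (auto simp: fun_eq_iff)
  qed (use assms in simp_all)
  then show ?thesis
    by (rule runs_weaken) (use assms(3) in \<open>auto simp: fun_eq_iff algebra_simps\<close>)
qed

section \<open>Cuts in bipartite graphs and the optimality estimate\<close>

text \<open>For disjoint \<open>X\<close> and \<open>Y\<close>, the case used in the gadget, this is
  the edge set of the complete bipartite graph.\<close>

definition bip :: "'a set \<Rightarrow> 'a set \<Rightarrow> 'a set set" where
  "bip X Y = (\<lambda>(x, y). {x, y}) ` (X \<times> Y)"

lemma inj_on_doubleton: "X \<inter> Y = {} \<Longrightarrow> inj_on (\<lambda>(x, y). {x, y}) (X \<times> Y)"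
  by (auto simp: inj_on_def doubleton_eq_iff)

lemma card_bip: "X \<inter> Y = {} \<Longrightarrow> card (bip X Y) = card X * card Y"
  unfolding bip_def by (simp add: card_image inj_on_doubleton card_cartesian_product)

lemma card_doubleton_Int: "x \<noteq> y \<Longrightarrow> card ({x, y} \<inter> A) = of_bool (x \<in> A) + of_bool (y \<in> A)"
  by (auto simp: Int_insert_left)

lemma doubleton_in_cut_iff: "x \<noteq> y \<Longrightarrow> {x, y} \<in> cut E A \<longleftrightarrow> {x, y} \<in> E \<and> (x \<in> A \<longleftrightarrow> y \<notin> A)"
  unfolding cut_def by (auto simp: card_doubleton_Int)

lemma cut_bip:
  assumes "X \<inter> Y = {}"
  shows "cut (bip X Y) A = bip (X \<inter> A) (Y - A) \<union> bip (X - A) (Y \<inter> A)"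
proof -
  have "x \<noteq> y" if "x \<in> X" "y \<in> Y" for x y using assms that by auto
  then show ?thesis
    unfolding cut_def bip_def by (auto simp: card_doubleton_Int image_iff of_bool_def split: if_splits) blast+
qed

lemma card_cut_bip:
  assumes "finite X" "finite Y" "X \<inter> Y = {}"
  shows "card (cut (bip X Y) A)
    = card (X \<inter> A) * (card Y - card (Y \<inter> A)) + (card X - card (X \<inter> A)) * card (Y \<inter> A)"
proof -
  have "bip (X \<inter> A) (Y - A) \<inter> bip (X - A) (Y \<inter> A) = {}"
    using assms(3) unfolding bip_def by (auto simp: doubleton_eq_iff)
  moreover have "finite (bip (X \<inter> A) (Y - A))" "finite (bip (X - A) (Y \<inter> A))"
    using assms unfolding bip_def by auto
  ultimately have "card (cut (bip X Y) A) = card (bip (X \<inter> A) (Y - A)) + card (bip (X - A) (Y \<inter> A))"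
    by (simp add: cut_bip[OF assms(3)] card_Un_disjoint)
  also have "card (bip (X \<inter> A) (Y - A)) = card (X \<inter> A) * card (Y - A)"
    by (rule card_bip) (use assms(3) in auto)
  also have "card (bip (X - A) (Y \<inter> A)) = card (X - A) * card (Y \<inter> A)"
    by (rule card_bip) (use assms(3) in auto)
  finally show ?thesis
    using assms by (simp add: card_Diff_subset_Int)
qed

text \<open>Orienting each cut edge out of \<open>A\<close> turns cut sizes into counts of ordered
  pairs, both for bounding them and for the count made by the program. \<open>A\<close> may reach
  beyond \<open>V\<close>, hence \<open>V \<inter> A\<close>.\<close>

lemma cut_eq_image:
  assumes "graph V E"
  shows "cut E A = (\<lambda>(x, y). {x, y}) ` {(x, y) \<in> (V \<inter> A) \<times> (V - A). {x, y} \<in> E}"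
    (is "_ = _ ` ?P")
proof
  show "cut E A \<subseteq> (\<lambda>(x, y). {x, y}) ` ?P"
  proof
    fix e assume e: "e \<in> cut E A"
    then obtain u v where uv: "u \<in> V" "v \<in> V" "u \<noteq> v" "e = {u, v}"
      using assms unfolding graph_def cut_def by blast
    with e have "{u, v} \<in> E" "u \<in> A \<longleftrightarrow> v \<notin> A" by (auto simp: doubleton_in_cut_iff)
    with uv have "(u, v) \<in> ?P \<or> (v, u) \<in> ?P" by (auto simp: insert_commute)
    then show "e \<in> (\<lambda>(x, y). {x, y}) ` ?P"
    proof
      assume "(u, v) \<in> ?P" then show ?thesis by (rule rev_image_eqI) (simp add: uv)
    next
      assume "(v, u) \<in> ?P" then show ?thesis by (rule rev_image_eqI) (simp add: uv insert_commute)
    qed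
  qed
  show "(\<lambda>(x, y). {x, y}) ` ?P \<subseteq> cut E A"
    by (auto simp: cut_def card_doubleton_Int)
qed

lemma card_cut_eq:
  assumes "graph V E"
  shows "card (cut E A) = card {(x, y) \<in> (V \<inter> A) \<times> (V - A). {x, y} \<in> E}"
proof -
  have "inj_on (\<lambda>(x, y). {x, y}) {(x, y) \<in> (V \<inter> A) \<times> (V - A). {x, y} \<in> E}"
    by (rule inj_on_subset[OF inj_on_doubleton[of "V \<inter> A" "V - A"]]) auto
  then show ?thesis by (simp add: cut_eq_image[OF assms] card_image)
qed

lemma card_cut_le:
  assumes "graph V E"
  shows "card (cut E A) \<le> card (V \<inter> A) * (card V - card (V \<inter> A))"
proof -
  have V: "finite V" using assms by (simp add: graph_def)
  then have "card {(x, y) \<in> (V \<inter> A) \<times> (V - A). {x, y} \<in> E} \<le> card ((V \<inter> A) \<times> (V - A))"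
    by (intro card_mono) auto
  also have "\<dots> = card (V \<inter> A) * (card V - card (V \<inter> A))"
    using V by (simp add: card_cartesian_product card_Diff_subset_Int)
  finally show ?thesis by (simp add: card_cut_eq[OF assms])
qed

text \<open>The oracle returns a side of the augmented graph; only its trace on the original
  vertices affects the original cut.\<close>

lemma cut_Int_vertices: "graph V E \<Longrightarrow> cut E (V \<inter> A) = cut E A"
  by (simp add: cut_eq_image Int_assoc[symmetric] Diff_Int)

text \<open>Here \<open>x\<close>, \<open>a\<close>, \<open>b\<close> are the sizes of the traces of the optimal side on the original vertices and on
  the two added parts, \<open>c\<close> is its cut in the original graph and \<open>d\<close> the cut that it is compared with.\<close>

lemma optimal_arith_half:
  fixes x n M a b c d :: int
  assumes "0 \<le> x" "x \<le> n" "0 \<le> a" "0 \<le> b" "a + b \<le> M" "0 \<le> c" "c \<le> x * (n - x)" "0 \<le> d"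
    and "n * n < 2 * M" "0 < n" "x \<noteq> 0 \<or> a + b \<noteq> 0"
    and opt: "(M * M + d) * (x * (2 * M - (a + b)) + (n - x) * (a + b))
      \<le> (a * (M - b) + (M - a) * b + c) * (n * M)"
  shows "d \<le> c"
proof -
  define \<sigma> where "\<sigma> = a + b"
  have M: "0 < M" using assms(9,10) by (smt (verit) mult_pos_pos)
  have \<sigma>: "0 \<le> \<sigma>" "\<sigma> \<le> M" using assms by (auto simp: \<sigma>_def)
  \<comment> \<open>Both counts are put in terms of \<open>\<sigma>\<close>: the negative one equals
    \<open>n * \<sigma> + 2 * x * (M - \<sigma>)\<close>, the positive one
    \<open>\<sigma> * M - 2 * a * b + c\<close>, whose term in \<open>a * b\<close> is dropped. The
    common product \<open>M * M * n * \<sigma>\<close> then cancels and leaves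
    \<open>key\<close>.\<close>
  have "(M * M + d) * (n * \<sigma> + 2 * x * (M - \<sigma>)) \<le> (a * (M - b) + (M - a) * b + c) * (n * M)"
    using opt by (simp add: \<sigma>_def algebra_simps)
  also have "a * (M - b) + (M - a) * b + c \<le> \<sigma> * M + c"
    using assms(3,4) by (simp add: \<sigma>_def algebra_simps)
  then have "(a * (M - b) + (M - a) * b + c) * (n * M) \<le> (\<sigma> * M + c) * (n * M)"
    using M assms(10) by (intro mult_right_mono) auto
  finally have key: "2 * x * (M - \<sigma>) * (M * M) + d * (n * \<sigma>) + d * (2 * x * (M - \<sigma>)) \<le> c * (n * M)"
    by (simp add: algebra_simps)
  have nn: "0 \<le> d * (2 * x * (M - \<sigma>))" "0 \<le> d * (n * \<sigma>)"
    using assms \<sigma> by simp_all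
  \<comment> \<open>For \<open>\<sigma> = M\<close>, \<open>key\<close> is the claim up to a
    positive factor. If \<open>x = 0\<close>, then \<open>c = 0\<close>, and nontriviality gives
    \<open>0 < \<sigma>\<close>, which forces \<open>d = 0\<close>. In the last case the first term
    of \<open>key\<close> alone exceeds the right side, so that case is contradictory.\<close>
  consider "\<sigma> = M" | "\<sigma> < M" "x = 0" | "\<sigma> < M" "0 < x" using \<sigma> assms(1) by linarith
  then show ?thesis
  proof cases
    case 1
    with key have "d * (n * M) \<le> c * (n * M)" by simp
    then show ?thesis using M assms(10) by (simp add: mult_le_cancel_right)
  next
    case 2
    then have "c = 0" "0 < \<sigma>" using assms \<sigma> by (auto simp: \<sigma>_def)
    with key 2 have "d * (n * \<sigma>) \<le> 0" by simp
    moreover have "0 < n * \<sigma>" using \<open>0 < \<sigma>\<close> assms(10) by simp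
    ultimately show ?thesis using \<open>c = 0\<close> by (metis mult_pos_pos not_le)
  next
    case 3
    \<comment> \<open>Here \<open>n * n < 2 * M\<close> enters: it makes \<open>c * (n * M)\<close>
      smaller than \<open>2 * x * (M * M)\<close>.\<close>
    have "c \<le> x * n" using assms(1,7) by (smt (verit) mult_left_mono)
    then have "c * (n * M) \<le> x * n * (n * M)" using M assms(10) by (intro mult_right_mono) auto
    also have "\<dots> = (x * M) * (n * n)" by simp
    also have "\<dots> < (x * M) * (2 * M)" using 3 M assms(9) by (intro mult_strict_left_mono) auto
    also have "\<dots> = 2 * x * 1 * (M * M)" by simp
    also have "\<dots> \<le> 2 * x * (M - \<sigma>) * (M * M)" using 3 by (intro mult_right_mono mult_left_mono) auto
    finally show ?thesis using key nn by linarith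
  qed
qed

text \<open>The final hypothesis is the cross-multiplied comparison with a cut that separates the
  two added parts and so has \<open>M * M + d\<close> positive and \<open>n * M\<close> negative
  edges. The two before it exclude the empty and the full side. All of this is symmetric under
  complementing the side.\<close>

lemma optimal_arith:
  fixes x n M a b c d :: int
  assumes "0 \<le> x" "x \<le> n" "0 \<le> a" "a \<le> M" "0 \<le> b" "b \<le> M"
    and "0 \<le> c" "c \<le> x * (n - x)" "0 \<le> d" "n * n < 2 * M" "0 < n"
    and "x \<noteq> 0 \<or> a + b \<noteq> 0" "x \<noteq> n \<or> a + b \<noteq> 2 * M"
    and "(M * M + d) * (x * (2 * M - (a + b)) + (n - x) * (a + b))
      \<le> (a * (M - b) + (M - a) * b + c) * (n * M)"
  shows "d \<le> c"
proof (cases "a + b \<le> M") \<comment> \<open>otherwise pass to the complementary side\<close>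
  case True
  then show ?thesis using assms optimal_arith_half[of x n a b M c d] by blast
next
  case False
  show ?thesis
    by (rule optimal_arith_half[of "n - x" n "M - a" "M - b" M c d])
      (use False assms in \<open>auto simp: algebra_simps\<close>)
qed

section \<open>The augmented graph\<close>

abbreviation (input) left_part :: "nat \<Rightarrow> nat \<Rightarrow> nat set" where
  "left_part n m \<equiv> {n..<n + m}"

abbreviation (input) right_part :: "nat \<Rightarrow> nat \<Rightarrow> nat set" where
  "right_part n m \<equiv> {n + m..<n + 2 * m}"

definition gadget_edges :: "nat \<Rightarrow> nat \<Rightarrow> nat set set \<Rightarrow> nat set set" where
  "gadget_edges n m E =
    E \<union> bip {..<n} {n..<n + 2 * m} \<union> bip (left_part n m) (right_part n m)"

definition gadget_weight :: "nat \<Rightarrow> nat \<Rightarrow> nat set \<Rightarrow> int" where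
  "gadget_weight n m e = (if e \<in> bip {..<n} {n..<n + 2 * m} then -1 else 1)"

lemma bip_iff:
  "{i, j} \<in> bip X Y \<longleftrightarrow> i \<in> X \<and> j \<in> Y \<or> j \<in> X \<and> i \<in> Y"
  unfolding bip_def by (auto simp: image_iff doubleton_eq_iff)

lemma bipD: "e \<in> bip X Y \<Longrightarrow> e \<subseteq> X \<union> Y \<and> e \<inter> X \<noteq> {} \<and> e \<inter> Y \<noteq> {}"
  unfolding bip_def by auto

lemma graph_edgeD:
  "graph V E \<Longrightarrow> {i, j} \<in> E \<Longrightarrow> i \<in> V \<and> j \<in> V \<and> i \<noteq> j"
  unfolding graph_def by (metis doubleton_eq_iff)

text \<open>Block form of the adjacency matrix, from which connectedness and the encoding are both
  read off.\<close>

lemma gadget_edge_iff: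
  assumes "graph {..<n} E"
  shows "{i, j} \<in> gadget_edges n m E \<longleftrightarrow>
    (if i < n then if j < n then {i, j} \<in> E else j < n + 2 * m
     else if j < n then i < n + 2 * m
     else if i < n + m then n + m \<le> j \<and> j < n + 2 * m
     else i < n + 2 * m \<and> j < n + m)"
  using graph_edgeD[OF assms, of i j] unfolding gadget_edges_def by (auto simp: bip_iff)

lemma gadget_weight_iff:
  "i < n + 2 * m \<Longrightarrow> j < n + 2 * m \<Longrightarrow> gadget_weight n m {i, j} = 1 \<longleftrightarrow> (i < n \<longleftrightarrow> j < n)"
  unfolding gadget_weight_def by (auto simp: bip_iff)

lemma graph_gadget:
  assumes "graph {..<n} E"
  shows "graph {..<n + 2 * m} (gadget_edges n m E)"
proof -
  have "\<exists>u\<in>{..<n + 2 * m}. \<exists>v\<in>{..<n + 2 * m}. u \<noteq> v \<and> e = {u, v}"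
    if e: "e \<in> gadget_edges n m E" for e
  proof -
    consider "e \<in> E" | "e \<in> bip {..<n} {n..<n + 2 * m}" | "e \<in> bip (left_part n m) (right_part n m)"
      using e unfolding gadget_edges_def by blast
    then have "\<exists>u v. u < n + 2 * m \<and> v < n + 2 * m \<and> u \<noteq> v \<and> e = {u, v}"
    proof cases
      case 1
      then obtain u v where "u < n" "v < n" "u \<noteq> v" "e = {u, v}"
        using assms unfolding graph_def by auto
      then have "u < n + 2 * m" "v < n + 2 * m" "u \<noteq> v" by auto
      with \<open>e = {u, v}\<close> show ?thesis by blast
    next
      case 2
      then obtain u v where "u < n" "n \<le> v" "v < n + 2 * m" "e = {u, v}"
        unfolding bip_def by auto
      then have "u < n + 2 * m" "v < n + 2 * m" "u \<noteq> v" by auto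
      with \<open>e = {u, v}\<close> show ?thesis by blast
    next
      case 3
      then obtain u v where "u < n + m" "n + m \<le> v" "v < n + 2 * m" "e = {u, v}"
        unfolding bip_def by auto
      then have "u < n + 2 * m" "v < n + 2 * m" "u \<noteq> v" by auto
      with \<open>e = {u, v}\<close> show ?thesis by blast
    qed
    then show ?thesis by blast
  qed
  then show ?thesis unfolding graph_def by simp
qed

text \<open>Vertex \<open>n\<close>, the first added one, is adjacent to every original vertex, and
  every added vertex is adjacent to \<open>0\<close>; so every vertex reaches \<open>n\<close> and
  is reached from it.\<close>

lemma connected_gadget:
  assumes "graph {..<n} E" "0 < n" "0 < m"
  shows "connected_graph {..<n + 2 * m} (gadget_edges n m E)"
proof -
  define R where "R = {(x, y). {x, y} \<in> gadget_edges n m E}"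
  have R: "(x, y) \<in> R \<longleftrightarrow> {x, y} \<in> gadget_edges n m E" for x y by (simp add: R_def)
  have outer: "(x, n) \<in> R \<and> (n, x) \<in> R" if "x < n" for x
    using that assms(3) by (simp add: R gadget_edge_iff[OF assms(1)])
  have "(x, n) \<in> R\<^sup>* \<and> (n, x) \<in> R\<^sup>*" if x: "x < n + 2 * m" for x
  proof (cases "x < n")
    case True
    then show ?thesis using outer by blast
  next
    case False
    then have "(x, 0) \<in> R" "(0, x) \<in> R"
      using x assms(2) by (simp_all add: R gadget_edge_iff[OF assms(1)])
    then show ?thesis using outer[OF assms(2)]
      by (blast intro: converse_rtrancl_into_rtrancl)
  qed
  then have "(x, y) \<in> R\<^sup>*" if "x < n + 2 * m" "y < n + 2 * m" for x y
    using that rtrancl_trans[of x n R y] by blast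
  moreover have "{..<n + 2 * m} \<noteq> {}" using assms(2) by (auto simp: lessThan_empty_iff)
  ultimately show ?thesis
    unfolding connected_graph_def R_def[symmetric] using graph_gadget[OF assms(1), of m] by simp
qed

lemma graph_edge_subset: "graph V E \<Longrightarrow> e \<in> E \<Longrightarrow> e \<subseteq> V"
  unfolding graph_def by (elim conjE, drule (1) bspec) auto

lemma finite_graph_edges: "graph V E \<Longrightarrow> finite E"
  by (rule finite_subset[of _ "Pow V"]) (auto dest: graph_edge_subset simp: graph_def)

lemma finite_bip: "finite X \<Longrightarrow> finite Y \<Longrightarrow> finite (bip X Y)"
  unfolding bip_def by simp

lemma cut_Un: "cut (E \<union> F) A = cut E A \<union> cut F A"
  unfolding cut_def by auto

lemma finite_cut: "finite E \<Longrightarrow> finite (cut E A)"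
  unfolding cut_def by simp

text \<open>The three families of edges are pairwise disjoint, so the sizes of their cuts add up:
  \<open>p\<close> counts the cut edges of weight 1 and \<open>q\<close> those of weight -1.\<close>

lemma avg_cut_gadget:
  fixes A :: "nat set" and n m :: nat
  assumes "graph {..<n} E"
  defines "p \<equiv> card (cut E A) + card (cut (bip (left_part n m) (right_part n m)) A)"
    and "q \<equiv> card (cut (bip {..<n} {n..<n + 2 * m}) A)"
  shows "avg_cut (gadget_edges n m E) (gadget_weight n m) A = (real p - real q) / (real p + real q)"
proof -
  let ?P1 = "bip (left_part n m) (right_part n m)" and ?Q = "bip {..<n} {n..<n + 2 * m}"
  have fin: "finite (cut E A)" "finite (cut ?P1 A)" "finite (cut ?Q A)"
    using finite_graph_edges[OF assms(1)] by (auto intro!: finite_cut finite_bip)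
  have disjV: "{..<n} \<inter> right_part n m = {}" "{..<n} \<inter> {n..<n + 2 * m} = {}"
      "{..<n} \<inter> (left_part n m \<union> right_part n m) = {}" by auto
  have "e \<notin> ?P1" "e \<notin> ?Q" if "e \<in> E" for e
    using graph_edge_subset[OF assms(1) that] disjV(1,2) bipD[of e "left_part n m" "right_part n m"]
      bipD[of e "{..<n}" "{n..<n + 2 * m}"] by blast+
  moreover have "e \<notin> ?Q" if "e \<in> ?P1" for e
    using bipD[OF that] disjV(3) bipD[of e "{..<n}" "{n..<n + 2 * m}"] by blast
  ultimately have disj: "cut E A \<inter> cut ?P1 A = {}" "(cut E A \<union> cut ?P1 A) \<inter> cut ?Q A = {}"
    unfolding cut_def by auto
  have cut: "cut (gadget_edges n m E) A = (cut E A \<union> cut ?P1 A) \<union> cut ?Q A"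
    unfolding gadget_edges_def cut_Un by auto
  have p: "card (cut E A \<union> cut ?P1 A) = p"
    unfolding p_def using fin disj by (simp add: card_Un_disjoint)
  have "(\<Sum>e\<in>cut E A \<union> cut ?P1 A. gadget_weight n m e) = (\<Sum>e\<in>cut E A \<union> cut ?P1 A. 1)"
    by (rule sum.cong) (use disj(2) in \<open>auto simp: gadget_weight_def cut_def\<close>)
  moreover have "(\<Sum>e\<in>cut ?Q A. gadget_weight n m e) = (\<Sum>e\<in>cut ?Q A. - 1)"
    by (rule sum.cong) (auto simp: gadget_weight_def cut_def)
  ultimately have "(\<Sum>e\<in>cut (gadget_edges n m E) A. gadget_weight n m e) = int p - int q"
    unfolding cut using fin disj p by (simp add: sum.union_disjoint q_def)
  moreover have "card (cut (gadget_edges n m E) A) = p + q"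
    unfolding cut using fin disj p by (subst card_Un_disjoint) (auto simp: q_def)
  ultimately show ?thesis unfolding avg_cut_def by simp
qed

lemma frac_le_cross: "(x :: real) / y \<le> z / t \<Longrightarrow> 0 < y \<Longrightarrow> 0 < t \<Longrightarrow> x * t \<le> z * y"
  by (simp add: divide_le_eq le_divide_eq)

text \<open>For each \<open>D\<close> the optimal side is compared with a single competitor.
  Cross-multiplying the two averages gives the inequality that \<open>optimal_arith\<close> takes as
  input.\<close>

lemma gadget_optimal_max_cut:
  assumes G: "graph {..<n} E" and n: "0 < n" and m: "n * n < 2 * m" "n < m"
    and A: "nontrivial_partition {..<n + 2 * m} A B"
    and opt: "\<And>A' B'. nontrivial_partition {..<n + 2 * m} A' B' \<Longrightarrow>
      avg_cut (gadget_edges n m E) (gadget_weight n m) A'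
        \<le> avg_cut (gadget_edges n m E) (gadget_weight n m) A"
    and D: "D \<subseteq> {..<n}"
  shows "card (cut E D) \<le> card (cut E A)"
proof -
  let ?V = "{..<n}" and ?L = "left_part n m" and ?R = "right_part n m"
  let ?U = "{n..<n + 2 * m}"
  define x a b where "x = card (?V \<inter> A)" and "a = card (?L \<inter> A)" and "b = card (?R \<inter> A)"
  define c d where "c = card (cut E A)" and "d = card (cut E D)"
  have U: "?U = ?L \<union> ?R" by auto
  have UA: "card (?U \<inter> A) = a + b"
    unfolding U a_def b_def Int_Un_distrib2 by (rule card_Un_disjoint) auto
  have bounds: "x \<le> n" "a \<le> m" "b \<le> m"
    using card_mono[of ?V "?V \<inter> A"] card_mono[of ?L "?L \<inter> A"] card_mono[of ?R "?R \<inter> A"]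
    by (auto simp: x_def a_def b_def)
  have c: "c \<le> x * (n - x)"
    using card_cut_le[OF G, of A] by (simp add: x_def c_def)
  define p q where "p = c + (a * (m - b) + (m - a) * b)"
    and "q = x * (2 * m - (a + b)) + (n - x) * (a + b)"
  have "card (cut (bip ?L ?R) A) = a * (m - b) + (m - a) * b"
    by (subst card_cut_bip) (auto simp: a_def b_def)
  moreover have "card (cut (bip ?V ?U) A) = q"
    by (subst card_cut_bip) (auto simp: UA x_def q_def)
  ultimately have avgA: "avg_cut (gadget_edges n m E) (gadget_weight n m) A
      = (real p - real q) / (real p + real q)"
    using avg_cut_gadget[OF G, of m A] by (simp add: p_def c_def)
  \<comment> \<open>The competitor cuts every edge between \<open>?L\<close> and \<open>?R\<close>,
    and each original vertex meets exactly \<open>m\<close> cut edges of weight -1 whether or not it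
    lies in \<open>D\<close>.\<close>
  let ?D = "D \<union> ?L"
  have "?V \<inter> ?D = D" "?L \<inter> ?D = ?L" "?R \<inter> ?D = {}" "?U \<inter> ?D = ?L" using D by auto
  moreover have "cut E ?D = cut E D"
    using cut_Int_vertices[OF G, of ?D] \<open>?V \<inter> ?D = D\<close> by simp
  moreover have "card D \<le> n" using card_mono[OF _ D] by simp
  moreover from this have "card D * m + (n - card D) * m = n * m"
    by (metis add_mult_distrib le_add_diff_inverse)
  moreover from calculation have "card (cut (bip ?V ?U) ?D) = n * m"
    by (subst card_cut_bip) auto
  moreover from calculation have "card (cut (bip ?L ?R) ?D) = m * m"
    by (subst card_cut_bip) auto
  ultimately have avgD: "avg_cut (gadget_edges n m E) (gadget_weight n m) ?D
      = (real (d + m * m) - real (n * m)) / (real (d + m * m) + real (n * m))"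
    using avg_cut_gadget[OF G, of m ?D] by (simp add: d_def)
  have "n + m \<in> {..<n + 2 * m} - ?D" "n \<in> ?D" using D m by auto
  moreover have "?D \<subseteq> {..<n + 2 * m}" using D by auto
  ultimately have "nontrivial_partition {..<n + 2 * m} ?D ({..<n + 2 * m} - ?D)"
    unfolding nontrivial_partition_def vertex_partition_def by blast
  from opt[OF this] have le: "(real (d + m * m) - real (n * m)) / (real (d + m * m) + real (n * m))
      \<le> (real p - real q) / (real p + real q)"
    by (simp only: avgA avgD)
  have nm: "n * m < m * m" "0 < n * m" using m n by auto
  then have nm': "real (n * m) < real (d + m * m)" "0 < real (n * m)"
    by (simp_all only: of_nat_less_iff of_nat_0_less_iff trans_less_add2)
  \<comment> \<open>A cut without edges would have average 0, as division by zero yields 0. The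
    competitor's average is positive because \<open>n < m\<close>, so optimality rules this
    out.\<close>
  have pos: "0 < p + q"
  proof (rule ccontr)
    assume "\<not> 0 < p + q"
    then have "(real p - real q) / (real p + real q) = 0" by simp
    moreover have "0 < (real (d + m * m) - real (n * m)) / (real (d + m * m) + real (n * m))"
      by (rule divide_pos_pos) (use nm' in linarith)+
    ultimately show False using le by linarith
  qed
  have "(real (d + m * m) - real (n * m)) * (real p + real q)
      \<le> (real p - real q) * (real (d + m * m) + real (n * m))"
    by (rule frac_le_cross[OF le]) (use pos nm' in \<open>simp_all del: of_nat_add of_nat_mult add: of_nat_add[symmetric]\<close>)
  \<comment> \<open>With \<open>P = d + m * m\<close> and \<open>Q = n * m\<close> the inequality
    reads \<open>(P - Q) * (p + q) \<le> (p - q) * (P + Q)\<close>; the products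
    \<open>P * p\<close> and \<open>Q * q\<close> cancel.\<close>
  then have "real (d + m * m) * real q \<le> real p * real (n * m)"
    by (simp add: algebra_simps)
  then have "(d + m * m) * q \<le> p * (n * m)"
    by (simp only: of_nat_mult[symmetric] of_nat_le_iff)
  \<comment> \<open>The estimate is carried out over the integers, where no subtraction
    truncates.\<close>
  then have "int ((d + m * m) * q) \<le> int (p * (n * m))" by (simp only: of_nat_le_iff)
  moreover have "int p = int a * (int m - int b) + (int m - int a) * int b + int c"
    unfolding p_def using bounds by (simp add: of_nat_diff)
  moreover have "int q = int x * (2 * int m - (int a + int b)) + (int n - int x) * (int a + int b)"
    unfolding q_def using bounds by (simp add: of_nat_diff)
  ultimately have main: "(int m * int m + int d) *
        (int x * (2 * int m - (int a + int b)) + (int n - int x) * (int a + int b))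
      \<le> (int a * (int m - int b) + (int m - int a) * int b + int c) * (int n * int m)"
    by (simp add: add.commute)
  have AV: "A \<subseteq> {..<n + 2 * m}" "A \<noteq> {}" "A \<noteq> {..<n + 2 * m}"
    using A unfolding nontrivial_partition_def vertex_partition_def by auto
  \<comment> \<open>Through the size of \<open>A\<close>, nontriviality of the partition becomes a
    condition on the trace sizes \<open>x\<close>, \<open>a\<close> and \<open>b\<close>.\<close>
  have cardA: "card A = x + (a + b)"
  proof -
    have "A = (?V \<inter> A) \<union> (?U \<inter> A)" using AV by auto
    moreover have "(?V \<inter> A) \<inter> (?U \<inter> A) = {}" by auto
    ultimately have "card A = card (?V \<inter> A) + card (?U \<inter> A)"
      by (metis card_Un_disjoint finite_Int finite_atLeastLessThan finite_lessThan)
    then show ?thesis by (simp add: UA x_def)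
  qed
  have finA: "finite A" using AV finite_subset by blast
  then have "card A \<noteq> 0" using AV by simp
  moreover have "card A \<noteq> n + 2 * m"
    using card_subset_eq[OF _ AV(1)] AV(3) by auto
  ultimately have nontriv: "x \<noteq> 0 \<or> a + b \<noteq> 0" "x \<noteq> n \<or> a + b \<noteq> 2 * m"
    using cardA by auto
  have "int d \<le> int c"
  proof (rule optimal_arith[of "int x" "int n" "int a" "int m" "int b"])
    show "int c \<le> int x * (int n - int x)"
      using c bounds by (metis of_nat_diff of_nat_le_iff of_nat_mult)
    show "int n * int n < 2 * int m" using m(1) by (metis of_nat_less_iff of_nat_mult of_nat_numeral)
    show "int x \<noteq> 0 \<or> int a + int b \<noteq> 0" using nontriv(1) by auto
    show "int x \<noteq> int n \<or> int a + int b \<noteq> 2 * int m" using nontriv(2) by linarith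
  qed (use bounds n main in auto)
  then show ?thesis by (simp add: c_def d_def)
qed

text \<open>The right side is grouped as the loops of the program write it. Original edges have
  weight 1, so the two bits of their entries agree. In the rows of original vertices both added
  parts look alike, so a loop of \<open>m\<close> rounds can write two entries per round.\<close>

lemma enc_weighted_gadget:
  assumes "graph {..<n} E"
  shows "enc_weighted_graph (n + 2 * m) (gadget_edges n m E) (gadget_weight n m) =
    replicate n True @ concat (replicate m [True, True]) @ [False] @
    concat (map (\<lambda>i. concat (map (\<lambda>j. [{i, j} \<in> E, {i, j} \<in> E]) [0..<n]) @
      concat (replicate m [True, False, True, False])) [0..<n]) @
    concat (replicate m (concat (replicate n [True, False]) @
      concat (replicate m [False, False]) @ concat (replicate m [True, True]))) @
    concat (replicate m (concat (replicate n [True, False]) @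
      concat (replicate m [True, True]) @ concat (replicate m [False, False])))"
proof -
  define e where "e i j = [{i, j} \<in> gadget_edges n m E,
    {i, j} \<in> gadget_edges n m E \<and> gadget_weight n m {i, j} = 1]" for i j
  have upt: "[0..<n + 2 * m] = [0..<n] @ [n..<n + m] @ [n + m..<n + 2 * m]"
    by (simp add: upt_add_eq_append[symmetric] mult_2 add.assoc[symmetric])
      (metis add.assoc le_add1 upt_add_eq_append zero_le)
  have const: "concat (map g [a..<b]) = concat (replicate (b - a) z)"
    if "\<And>j. a \<le> j \<Longrightarrow> j < b \<Longrightarrow> g j = z" for g :: "nat \<Rightarrow> bool list" and a b z
  proof -
    have "map g [a..<b] = map (\<lambda>_. z) [a..<b]" using that by (intro map_cong) auto
    then show ?thesis by (simp add: map_replicate_const)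
  qed
  have dbl: "concat (replicate k z) @ concat (replicate k z) = concat (replicate k (z @ z))"
    for k and z :: "bool list"
  proof -
    have comm: "concat (replicate k z) @ z = z @ concat (replicate k z)" for k
      by (induction k) auto
    show ?thesis
    proof (induction k)
      case (Suc k)
      have "concat (replicate (Suc k) z) @ concat (replicate (Suc k) z)
          = z @ (concat (replicate k z) @ z) @ concat (replicate k z)" by simp
      then show ?case unfolding comm using Suc by simp
    qed simp
  qed
  have row1: "concat (map (e i) [0..<n + 2 * m]) =
      concat (map (\<lambda>j. [{i, j} \<in> E, {i, j} \<in> E]) [0..<n]) @
      concat (replicate m [True, False, True, False])" if "i < n" for i
  proof -
    have "concat (map (e i) [0..<n]) = concat (map (\<lambda>j. [{i, j} \<in> E, {i, j} \<in> E]) [0..<n])"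
      using that by (intro arg_cong[where f = concat] map_cong) (auto simp: e_def gadget_edge_iff[OF assms] gadget_weight_iff)
    moreover have "concat (map (e i) [n..<n + m]) = concat (replicate (n + m - n) [True, False])"
      using that by (intro const) (auto simp: e_def gadget_edge_iff[OF assms] gadget_weight_iff)
    moreover have "concat (map (e i) [n + m..<n + 2 * m])
        = concat (replicate (n + 2 * m - (n + m)) [True, False])"
      using that by (intro const) (auto simp: e_def gadget_edge_iff[OF assms] gadget_weight_iff)
    ultimately show ?thesis using dbl[of m "[True, False]"] by (simp add: upt)
  qed
  have row2: "concat (map (e i) [0..<n + 2 * m]) = concat (replicate n [True, False]) @
      concat (replicate m [False, False]) @ concat (replicate m [True, True])"
    if "n \<le> i" "i < n + m" for i
  proof -
    have "concat (map (e i) [0..<n]) = concat (replicate (n - 0) [True, False])"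
      using that by (intro const) (auto simp: e_def gadget_edge_iff[OF assms] gadget_weight_iff)
    moreover have "concat (map (e i) [n..<n + m]) = concat (replicate (n + m - n) [False, False])"
      using that by (intro const) (auto simp: e_def gadget_edge_iff[OF assms] gadget_weight_iff)
    moreover have "concat (map (e i) [n + m..<n + 2 * m])
        = concat (replicate (n + 2 * m - (n + m)) [True, True])"
      using that by (intro const) (auto simp: e_def gadget_edge_iff[OF assms] gadget_weight_iff)
    ultimately show ?thesis by (simp add: upt)
  qed
  have row3: "concat (map (e i) [0..<n + 2 * m]) = concat (replicate n [True, False]) @
      concat (replicate m [True, True]) @ concat (replicate m [False, False])"
    if "n + m \<le> i" "i < n + 2 * m" for i
  proof -
    have "concat (map (e i) [0..<n]) = concat (replicate (n - 0) [True, False])"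
      using that by (intro const) (auto simp: e_def gadget_edge_iff[OF assms] gadget_weight_iff)
    moreover have "concat (map (e i) [n..<n + m]) = concat (replicate (n + m - n) [True, True])"
      using that by (intro const) (auto simp: e_def gadget_edge_iff[OF assms] gadget_weight_iff)
    moreover have "concat (map (e i) [n + m..<n + 2 * m])
        = concat (replicate (n + 2 * m - (n + m)) [False, False])"
      using that by (intro const) (auto simp: e_def gadget_edge_iff[OF assms] gadget_weight_iff)
    ultimately show ?thesis by (simp add: upt)
  qed
  define row where "row i = concat (map (e i) [0..<n + 2 * m])" for i
  have "concat (map row [0..<n + 2 * m])
      = concat (map row [0..<n]) @ concat (map row [n..<n + m]) @ concat (map row [n + m..<n + 2 * m])"
    by (simp add: upt)
  also have "map row [0..<n] = map (\<lambda>i. concat (map (\<lambda>j. [{i, j} \<in> E, {i, j} \<in> E]) [0..<n]) @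
      concat (replicate m [True, False, True, False])) [0..<n]"
    unfolding row_def by (intro map_cong refl row1) auto
  also have "concat (map row [n..<n + m]) = concat (replicate (n + m - n) (concat (replicate n [True, False]) @
      concat (replicate m [False, False]) @ concat (replicate m [True, True])))"
    unfolding row_def by (intro const row2)
  also have "concat (map row [n + m..<n + 2 * m]) = concat (replicate (n + 2 * m - (n + m))
      (concat (replicate n [True, False]) @
      concat (replicate m [True, True]) @ concat (replicate m [False, False])))"
    unfolding row_def by (intro const row3)
  moreover have "replicate (n + 2 * m) True = replicate n True @ concat (replicate m [True, True])"
  proof -
    have "replicate (2 * m) True = concat (replicate m [True, True])" by (induction m) auto
    then show ?thesis by (simp add: replicate_add)
  qed
  ultimately show ?thesis
    unfolding enc_weighted_graph_def row_def e_def by simp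
qed

section \<open>The oracle program\<close>

text \<open>Registers: 0 the unread input, 1 the result, 2 a copy of the input, of which only the length
  \<open>m\<close> matters, 3 the number \<open>n\<close> of vertices in unary, 4 a second copy of the adjacency matrix,
  5 the reversed query, 6 and 7 loop counters, 8 the query, 9 the answer, 10 and 11 copies of the
  answer read along rows and columns, 12 the size of the cut in unary, 13 scratch space, 14 always
  empty.\<close>

definition parse :: com where
  "parse = Seq (Copy 0 2) (Seq (While (Top 0) (Seq (Pop 0) (Push 3 True))) (Seq (Pop 0) (Copy 0 4)))"

text \<open>Testing the top bit rather than nonemptiness stops the loop at the \<open>False\<close>
  that ends the unary \<open>n\<close>. The rest is kept twice, once for writing the query and once
  for counting.\<close>

lemma runs_parse:
  assumes "s 0 = replicate n True @ False # z" "s 3 = []" "length (s 0) \<le> B"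
  shows "runs f parse s (5 * B + 5) (s(2 := s 0, 0 := z, 3 := replicate n True, 4 := z))"
proof -
  let ?S = "\<lambda>i. s(2 := s 0, 0 := replicate (n - i) True @ False # z, 3 := replicate i True)"
  have "runs f (While (Top 0) (Seq (Pop 0) (Push 3 True))) (?S 0) (1 + n * ((1 + 1) + 1)) (?S n)"
  proof (rule runs_While)
    fix i assume i: "i < n"
    then have "n - i = Suc (n - Suc i)" by simp
    then show "holds (Top 0) (?S i) \<and> runs f (Seq (Pop 0) (Push 3 True)) (?S i) (1 + 1) (?S (Suc i))"
      by (auto intro!: runs_weaken[OF runs_Seq[OF runs_Pop runs_Push]] simp: fun_eq_iff)
  qed simp
  moreover have "?S 0 = s(2 := s 0)" using assms(1,2) by (auto simp: fun_eq_iff)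
  ultimately have w: "runs f (While (Top 0) (Seq (Pop 0) (Push 3 True))) (s(2 := s 0)) (1 + n * 3) (?S n)"
    by (simp add: numeral_3_eq_3)
  show ?thesis
    unfolding parse_def
    by (rule runs_weaken[OF runs_Seq[OF runs_Copy runs_Seq[OF w runs_Seq[OF runs_Pop runs_Copy]]]])
      (use assms in \<open>auto simp: fun_eq_iff\<close>)
qed

definition emit_header :: com where
  "emit_header = Seq (For 3 7 (emit 5 [True])) (Seq (For 2 7 (emit 5 [True, True])) (Push 5 False))"

lemma runs_emit_header:
  assumes "length (s 3) = n" "length (s 2) = m" "n \<le> B" "m \<le> B" "s 7 = []"
  shows "runs f emit_header s (11 * B + 5)
    (s(5 := rev (replicate n True @ concat (replicate m [True, True]) @ [False]) @ s 5))"
proof -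
  have "concat (replicate n [True]) = replicate n True" by (induction n) auto
  then show ?thesis
    unfolding emit_header_def
    by (intro runs_weaken[OF runs_Seq[OF runs_For_emit[where m = n and B = B]
            runs_Seq[OF runs_For_emit[where m = m and B = B] runs_Push]]])
      (use assms in \<open>auto simp: fun_eq_iff\<close>)
qed

definition emit_entry :: com where
  "emit_entry = Seq (Cond (Top 4) (emit 5 [True, True]) (emit 5 [False, False])) (Pop 4)"

lemma runs_emit_entry:
  assumes "s 4 = b # z"
  shows "runs f emit_entry s 5 (s(4 := z, 5 := [b, b] @ s 5))"
proof -
  have "runs f (Cond (Top 4) (emit 5 [True, True]) (emit 5 [False, False])) s (1 + 3)
      (s(5 := [b, b] @ s 5))"
    by (rule runs_Cond; rule runs_weaken[OF runs_emit]) (use assms in auto)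
  from runs_Seq[OF this runs_Pop] show ?thesis
    unfolding emit_entry_def by (rule runs_weaken) (use assms in \<open>auto simp: fun_eq_iff\<close>)
qed

definition emit_graph_row :: com where
  "emit_graph_row = Seq (For 3 7 emit_entry) (For 2 7 (emit 5 [True, False, True, False]))"

lemma runs_emit_graph_row:
  assumes "length (s 3) = n" "length (s 2) = m" "n \<le> B" "m \<le> B" "s 7 = []"
    and "s 4 = map g [0..<n] @ z"
  shows "runs f emit_graph_row s (16 * B + 4) (s(4 := z, 5 :=
    rev (concat (map (\<lambda>j. [g j, g j]) [0..<n]) @ concat (replicate m [True, False, True, False])) @ s 5))"
proof -
  let ?S = "\<lambda>i. s(4 := map g [i..<n] @ z, 5 := rev (concat (map (\<lambda>j. [g j, g j]) [0..<i])) @ s 5)"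
  have "runs f (For 3 7 emit_entry) s (2 + B + B * (5 + 2)) ((?S n)(7 := []))"
  proof (rule runs_For[where S = ?S])
    fix i v assume i: "i < n"
    show "runs f emit_entry ((?S i)(7 := v)) 5 ((?S (Suc i))(7 := v))"
      by (rule runs_weaken[OF runs_emit_entry[of _ "g i" "map g [Suc i..<n] @ z"]])
        (use i in \<open>auto simp: fun_eq_iff upt_conv_Cons\<close>)
  qed (use assms in \<open>auto simp: fun_eq_iff\<close>)
  from runs_Seq[OF this runs_For_emit[where m = m and B = B]] show ?thesis
    unfolding emit_graph_row_def
    by (rule runs_weaken) (use assms in \<open>auto simp: fun_eq_iff\<close>)
qed

definition emit_graph_rows :: com where
  "emit_graph_rows = For 3 6 emit_graph_row"

lemma runs_emit_graph_rows:
  assumes "length (s 3) = n" "length (s 2) = m" "n \<le> B" "m \<le> B" "s 6 = []" "s 7 = []"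
    and "s 4 = concat (map (\<lambda>i. map (g i) [0..<n]) [0..<n]) @ z"
  shows "runs f emit_graph_rows s (2 + B + B * ((16 * B + 4) + 2)) (s(4 := z, 5 :=
    rev (concat (map (\<lambda>i. concat (map (\<lambda>j. [g i j, g i j]) [0..<n]) @
      concat (replicate m [True, False, True, False])) [0..<n])) @ s 5))"
proof -
  let ?S = "\<lambda>i. s(4 := concat (map (\<lambda>i. map (g i) [0..<n]) [i..<n]) @ z, 5 :=
    rev (concat (map (\<lambda>i. concat (map (\<lambda>j. [g i j, g i j]) [0..<n]) @
      concat (replicate m [True, False, True, False])) [0..<i])) @ s 5)"
  have "runs f emit_graph_rows s (2 + B + B * ((16 * B + 4) + 2)) ((?S n)(6 := []))"
    unfolding emit_graph_rows_def
  proof (rule runs_For[where S = ?S])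
    fix i v assume i: "i < n"
    show "runs f emit_graph_row ((?S i)(6 := v)) (16 * B + 4) ((?S (Suc i))(6 := v))"
      by (rule runs_weaken[OF runs_emit_graph_row[of _ n m B "g i"
              "concat (map (\<lambda>i. map (g i) [0..<n]) [Suc i..<n]) @ z"]])
        (use i assms in \<open>auto simp: fun_eq_iff upt_conv_Cons\<close>)
  qed (use assms in \<open>auto simp: fun_eq_iff\<close>)
  then show ?thesis by (rule runs_weaken) (use assms in \<open>auto simp: fun_eq_iff\<close>)
qed

text \<open>The bits \<open>a\<close> and \<open>b\<close> tell whether the row vertex is joined to
  the left and to the right part: \<open>False\<close>, \<open>True\<close> gives the rows of the
  left part and \<open>True\<close>, \<open>False\<close> those of the right part.\<close>

definition emit_block_rows :: "bool \<Rightarrow> bool \<Rightarrow> com" where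
  "emit_block_rows a b = For 2 6 (Seq (For 3 7 (emit 5 [True, False]))
    (Seq (For 2 7 (emit 5 [a, a])) (For 2 7 (emit 5 [b, b]))))"

lemma runs_emit_block_rows:
  assumes "length (s 3) = n" "length (s 2) = m" "n \<le> B" "m \<le> B" "s 6 = []" "s 7 = []"
  shows "runs f (emit_block_rows a b) s (2 + B + B * ((18 * B + 6) + 2)) (s(5 :=
    rev (concat (replicate m (concat (replicate n [True, False]) @
      concat (replicate m [a, a]) @ concat (replicate m [b, b])))) @ s 5))"
    (is "runs _ _ _ _ (s(5 := rev (concat (replicate m ?row)) @ s 5))")
proof -
  let ?S = "\<lambda>i. s(5 := rev (concat (replicate i ?row)) @ s 5)"
  have "runs f (emit_block_rows a b) s (2 + B + B * ((18 * B + 6) + 2)) ((?S m)(6 := []))"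
    unfolding emit_block_rows_def
  proof (rule runs_For[where S = ?S])
    fix i v assume i: "i < m"
    have "concat (replicate (Suc i) ?row) = concat (replicate i ?row) @ ?row"
      by (induction i) auto
    then show "runs f (Seq (For 3 7 (emit 5 [True, False]))
        (Seq (For 2 7 (emit 5 [a, a])) (For 2 7 (emit 5 [b, b])))) ((?S i)(6 := v)) (18 * B + 6)
        ((?S (Suc i))(6 := v))"
      by (intro runs_weaken[OF runs_Seq[OF runs_For_emit[where m = n and B = B]
            runs_Seq[OF runs_For_emit[where m = m and B = B] runs_For_emit[where m = m and B = B]]]])
        (use assms in \<open>simp_all add: fun_eq_iff del: replicate.simps\<close>)
  qed (use assms in \<open>auto simp: fun_eq_iff\<close>)
  then show ?thesis by (rule runs_weaken) (use assms in \<open>auto simp: fun_eq_iff\<close>)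
qed

definition reverse :: com where
  "reverse = While (Nonempty 5) (Seq (Cond (Top 5) (Push 8 True) (Push 8 False)) (Pop 5))"

lemma runs_reverse:
  assumes "s 8 = []"
  shows "runs f reverse s (1 + length (s 5) * (3 + 1)) (s(5 := [], 8 := rev (s 5)))"
proof -
  let ?S = "\<lambda>i. s(5 := drop i (s 5), 8 := rev (take i (s 5)))"
  have "runs f reverse (?S 0) (1 + length (s 5) * (3 + 1)) (?S (length (s 5)))"
    unfolding reverse_def
  proof (rule runs_While)
    fix i assume i: "i < length (s 5)"
    then have d: "drop i (s 5) = (s 5 ! i) # drop (Suc i) (s 5)" by (simp add: Cons_nth_drop_Suc)
    have "runs f (Cond (Top 5) (Push 8 True) (Push 8 False)) (?S i) (1 + 1)
        ((?S i)(8 := s 5 ! i # rev (take i (s 5))))"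
      by (rule runs_Cond; rule runs_weaken[OF runs_Push]) (auto simp: d)
    from runs_Seq[OF this runs_Pop[where r = 5]]
    have "runs f (Seq (Cond (Top 5) (Push 8 True) (Push 8 False)) (Pop 5)) (?S i) 3 (?S (Suc i))"
      by (rule runs_weaken) (use i in \<open>auto simp: fun_eq_iff d take_Suc_conv_app_nth\<close>)
    with i show "holds (Nonempty 5) (?S i) \<and>
        runs f (Seq (Cond (Top 5) (Push 8 True) (Push 8 False)) (Pop 5)) (?S i) 3 (?S (Suc i))"
      by simp
  qed simp
  moreover have "?S 0 = s" using assms by (auto simp: fun_eq_iff)
  ultimately show ?thesis by simp
qed

section \<open>Counting the cut edges\<close>

definition count_entry :: com where
  "count_entry = Seq (Cond (Top 0) (Cond (Top 10) (Cond (Top 11) Skip (Push 12 True)) Skip) Skip)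
    (Seq (Pop 0) (Pop 11))"

text \<open>The symmetric matrix lists each edge twice; counting only entries with row vertex inside
  and column vertex outside meets each cut edge once.\<close>

lemma runs_count_entry:
  assumes "s 0 = a # u" "s 10 = b # v" "s 11 = c # w"
  shows "runs f count_entry s 6
    (s(0 := u, 11 := w, 12 := replicate (of_bool (a \<and> b \<and> \<not> c)) True @ s 12))"
proof -
  let ?s = "s(12 := replicate (of_bool (a \<and> b \<and> \<not> c)) True @ s 12)"
  have "runs f (Cond (Top 0) (Cond (Top 10) (Cond (Top 11) Skip (Push 12 True)) Skip) Skip) s
      (1 + (1 + (1 + 1))) ?s"
    by (rule runs_Cond)+
      (rule runs_weaken[OF runs_Skip] runs_weaken[OF runs_Push], use assms in \<open>auto simp: fun_eq_iff\<close>)+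
  from runs_Seq[OF this runs_Seq[OF runs_Pop runs_Pop]] show ?thesis
    unfolding count_entry_def by (rule runs_weaken) (use assms in \<open>auto simp: fun_eq_iff\<close>)
qed

definition count_row :: com where
  "count_row = Seq (Copy 9 11) (Seq (For 3 7 count_entry) (Pop 10))"

text \<open>Only the first \<open>n\<close> bits of the answer are read, which amounts to
  restricting its partition to the original vertices; \<open>w\<close> holds the bits of the added
  ones.\<close>

lemma runs_count_row:
  assumes "length (s 3) = n" "n \<le> B" "s 7 = []" "length (s 9) \<le> B'"
    and "s 0 = map g [0..<n] @ u" "s 10 = b # v" "s 9 = map h [0..<n] @ w"
  shows "runs f count_row s (9 * B + B' + 4) (s(0 := u, 10 := v, 11 := w,
    12 := replicate (\<Sum>j<n. of_bool (g j \<and> b \<and> \<not> h j)) True @ s 12))"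
proof -
  let ?S = "\<lambda>i. s(0 := map g [i..<n] @ u, 11 := map h [i..<n] @ w,
    12 := replicate (\<Sum>j<i. of_bool (g j \<and> b \<and> \<not> h j)) True @ s 12)"
  have "runs f (For 3 7 count_entry) (s(11 := s 9)) (2 + B + B * (6 + 2)) ((?S n)(7 := []))"
  proof (rule runs_For[where S = ?S])
    fix i x assume i: "i < n"
    show "runs f count_entry ((?S i)(7 := x)) 6 ((?S (Suc i))(7 := x))"
      by (rule runs_weaken[OF runs_count_entry[of _ "g i" "map g [Suc i..<n] @ u" b v "h i"
              "map h [Suc i..<n] @ w"]])
        (use i assms in \<open>auto simp: fun_eq_iff upt_conv_Cons\<close>)
  qed (use assms in \<open>auto simp: fun_eq_iff\<close>)
  from runs_Seq[OF runs_Copy runs_Seq[OF this runs_Pop]] show ?thesis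
    unfolding count_row_def by (rule runs_weaken) (use assms in \<open>auto simp: fun_eq_iff\<close>)
qed

definition count_cut :: com where
  "count_cut = Seq (Copy 9 10) (For 3 6 count_row)"

lemma runs_count_cut:
  assumes "length (s 3) = n" "n \<le> B" "s 6 = []" "s 7 = []" "length (s 9) \<le> B'" "s 12 = []"
    and "s 0 = concat (map (\<lambda>i. map (g i) [0..<n]) [0..<n]) @ u" "s 9 = map h [0..<n] @ w"
  shows "\<exists>s'. runs f count_cut s (3 + B' + B + B * (9 * B + B' + 6)) s' \<and> s' 0 = u \<and>
    s' 12 = replicate (\<Sum>i<n. \<Sum>j<n. of_bool (g i j \<and> h i \<and> \<not> h j)) True \<and>
    s' 1 = s 1 \<and> s' 13 = s 13 \<and> s' 14 = s 14"
proof -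
  \<comment> \<open>Register 11 keeps its old content until the first row has been processed and
    holds the unread rest \<open>w\<close> after every row, hence the case distinction.\<close>
  let ?S = "\<lambda>i. s(0 := concat (map (\<lambda>i. map (g i) [0..<n]) [i..<n]) @ u,
    10 := map h [i..<n] @ w, 11 := if i = 0 then s 11 else w,
    12 := replicate (\<Sum>i<i. \<Sum>j<n. of_bool (g i j \<and> h i \<and> \<not> h j)) True)"
  have "runs f (For 3 6 count_row) (s(10 := s 9)) (2 + B + B * ((9 * B + B' + 4) + 2))
      ((?S n)(6 := []))"
  proof (rule runs_For[where S = ?S])
    fix i x assume i: "i < n"
    show "runs f count_row ((?S i)(6 := x)) (9 * B + B' + 4) ((?S (Suc i))(6 := x))"
      by (rule runs_weaken[OF runs_count_row[of _ n B B' "g i"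
              "concat (map (\<lambda>i. map (g i) [0..<n]) [Suc i..<n]) @ u" "h i" "map h [Suc i..<n] @ w" h w]])
        (use i assms in \<open>auto simp: fun_eq_iff upt_conv_Cons replicate_add[symmetric] add.commute\<close>)
  qed (use assms in \<open>auto simp: fun_eq_iff\<close>)
  from runs_Seq[OF runs_Copy this]
  have "runs f count_cut s (3 + B' + B + B * (9 * B + B' + 6)) ((?S n)(6 := []))"
    unfolding count_cut_def by (rule runs_weaken) (use assms in \<open>auto simp: algebra_simps\<close>)
  then show ?thesis by (intro exI[of _ "(?S n)(6 := [])"] conjI) simp_all
qed

section \<open>Comparing the count with the threshold\<close>

definition halve :: com where
  "halve = Seq (While (Nonempty 12) (Seq (Pop 12) (Cond (Nonempty 12) (Seq (Pop 12) (Push 13 True)) Skip)))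
    (Seq (Copy 13 12) (Copy 14 13))"

text \<open>Each round removes up to two units and pushes one only if there were two, which rounds
  down. Copying the always empty register 14 clears the scratch register for the next call.\<close>

lemma runs_halve:
  assumes "s 12 = replicate c True" "s 13 = []" "s 14 = []" "c \<le> B"
  shows "runs f halve s (6 * B + 3) (s(12 := replicate (c div 2) True))"
proof -
  let ?W = "While (Nonempty 12) (Seq (Pop 12) (Cond (Nonempty 12) (Seq (Pop 12) (Push 13 True)) Skip))"
  have loop: "runs f ?W s (1 + 5 * c) (s(12 := [], 13 := replicate (c div 2) True @ s 13))"
    if "s 12 = replicate c True" for s c
    using that
  proof (induction c arbitrary: s rule: less_induct)
    case (less c)
    \<comment> \<open>Truncated subtraction makes \<open>c - 2\<close> correct for a single
      remaining unit as well.\<close>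
    have body: "runs f (Seq (Pop 12) (Cond (Nonempty 12) (Seq (Pop 12) (Push 13 True)) Skip)) s (1 + (1 + 2))
        (s(12 := replicate (c - 2) True, 13 := replicate (of_bool (2 \<le> c)) True @ s 13))"
    proof (rule runs_Seq[OF runs_Pop], rule runs_Cond)
      assume "holds (Nonempty 12) (s(12 := tl (s 12)))"
      then have "2 \<le> c" using less.prems by auto
      moreover from this have "c = Suc (Suc (c - 2))" by simp
      then have "tl (tl (s 12)) = replicate (c - 2) True"
        using less.prems by (metis list.sel(3) replicate_Suc)
      ultimately show "runs f (Seq (Pop 12) (Push 13 True)) (s(12 := tl (s 12))) 2
        (s(12 := replicate (c - 2) True, 13 := replicate (of_bool (2 \<le> c)) True @ s 13))"
        by (intro runs_weaken[OF runs_Seq[OF runs_Pop runs_Push]]) (auto simp: fun_eq_iff)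
    next
      assume "\<not> holds (Nonempty 12) (s(12 := tl (s 12)))"
      then have "c < 2" using less.prems by auto
      moreover from this have "tl (s 12) = []" using less.prems by simp
      ultimately show "runs f Skip (s(12 := tl (s 12))) 2
        (s(12 := replicate (c - 2) True, 13 := replicate (of_bool (2 \<le> c)) True @ s 13))"
        by (intro runs_weaken[OF runs_Skip]) (auto simp: fun_eq_iff)
    qed
    show ?case
    proof (cases "c = 0")
      case True
      then show ?thesis using less.prems
        by (intro runs_weaken[OF runs_While_done]) (auto simp: fun_eq_iff)
    next
      case False
      have "runs f ?W s (1 + (1 + (1 + 2)) + (1 + 5 * (c - 2))) ((s(12 := replicate (c - 2) True,
          13 := replicate (of_bool (2 \<le> c)) True @ s 13))(12 := [],
          13 := replicate ((c - 2) div 2) True @ replicate (of_bool (2 \<le> c)) True @ s 13))"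
        by (rule runs_While_step[OF _ body], use False less.prems in simp)
          (rule runs_weaken[OF less.IH[of "c - 2"]], use False in auto)
      moreover have "c div 2 = (c - 2) div 2 + of_bool (2 \<le> c)" by (cases "2 \<le> c") auto
      ultimately show ?thesis
        by (elim runs_weaken) (use False in \<open>auto simp: fun_eq_iff replicate_add\<close>)
    qed
  qed
  from runs_Seq[OF loop[of s c, OF assms(1)] runs_Seq[OF runs_Copy runs_Copy]] show ?thesis
    unfolding halve_def by (rule runs_weaken) (use assms in \<open>auto simp: fun_eq_iff\<close>)
qed

text \<open>The unary number \<open>c\<close> is compared with a binary number \<open>b + 2 * k\<close> through
  \<open>b + 2 * k \<le> c \<longleftrightarrow> b \<le> c \<and> k \<le> (c - b) div 2\<close>.\<close>

fun unary_ge :: "nat \<Rightarrow> bool list \<Rightarrow> bool" where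
  "unary_ge c [] \<longleftrightarrow> True"
| "unary_ge c (b # bs) \<longleftrightarrow> \<not> (b \<and> c = 0) \<and> unary_ge ((c - of_bool b) div 2) bs"

lemma unary_ge_enc_nat: "unary_ge c (enc_nat k) \<longleftrightarrow> k \<le> c"
proof (induction k arbitrary: c rule: less_induct)
  case (less k)
  show ?case
  proof (cases "k = 0")
    case True
    then show ?thesis by (simp add: enc_nat.simps)
  next
    case False
    then have "unary_ge c (enc_nat k) \<longleftrightarrow> \<not> (odd k \<and> c = 0) \<and> k div 2 \<le> (c - of_bool (odd k)) div 2"
      by (subst enc_nat.simps) (simp add: less)
    also have "\<dots> \<longleftrightarrow> k \<le> c"
    proof (cases "odd k")
      case True
      then show ?thesis by (auto elim!: oddE)
    next
      case False
      then show ?thesis by (auto elim!: evenE)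
    qed
    finally show ?thesis .
  qed
qed

definition compare_bit :: com where
  "compare_bit = Seq (Cond (Top 0) (Cond (Nonempty 12) (Pop 12) (Seq (Pop 1) (Push 1 False))) Skip)
    (Seq (Pop 0) halve)"

lemma runs_compare_bit:
  assumes "s 0 = b # bs" "s 12 = replicate c True" "s 1 = [r]" "s 13 = []" "s 14 = []" "c \<le> B"
  shows "runs f compare_bit s (6 * B + 8)
    (s(0 := bs, 12 := replicate ((c - of_bool b) div 2) True, 1 := [r \<and> \<not> (b \<and> c = 0)]))"
proof -
  let ?s = "s(12 := replicate (c - of_bool b) True, 1 := [r \<and> \<not> (b \<and> c = 0)])"
  have "runs f (Cond (Top 0) (Cond (Nonempty 12) (Pop 12) (Seq (Pop 1) (Push 1 False))) Skip) s
      (1 + (1 + 2)) ?s"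
  proof (rule runs_Cond, rule runs_Cond)
    assume "holds (Top 0) s" "holds (Nonempty 12) s"
    then have "b" "c \<noteq> 0" using assms by auto
    moreover from this have "tl (replicate c True) = replicate (c - 1) True" by (cases c) auto
    ultimately show "runs f (Pop 12) s 2 ?s"
      using assms by (intro runs_weaken[OF runs_Pop]) (auto simp: fun_eq_iff)
  next
    assume "holds (Top 0) s" "\<not> holds (Nonempty 12) s"
    then have "b" "c = 0" using assms by auto
    then show "runs f (Seq (Pop 1) (Push 1 False)) s 2 ?s"
      using assms by (intro runs_weaken[OF runs_Seq[OF runs_Pop runs_Push]]) (auto simp: fun_eq_iff)
  next
    assume "\<not> holds (Top 0) s"
    then have "\<not> b" using assms by auto
    then show "runs f Skip s (1 + 2) ?s"
      using assms by (intro runs_weaken[OF runs_Skip]) (auto simp: fun_eq_iff)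
  qed
  from runs_Seq[OF this runs_Seq[OF runs_Pop runs_halve[where c = "c - of_bool b" and B = B]]]
  show ?thesis unfolding compare_bit_def
    by (rule runs_weaken) (use assms in \<open>auto simp: fun_eq_iff\<close>)
qed

text \<open>The loop does not stop at a failed bit: register 1 accumulates a conjunction, so a
  \<open>False\<close> in it is never revoked.\<close>

lemma runs_compare_loop:
  assumes "s 0 = bs" "s 12 = replicate c True" "s 1 = [r]" "s 13 = []" "s 14 = []" "c \<le> B"
  shows "\<exists>s'. runs f (While (Nonempty 0) compare_bit) s (1 + length bs * (6 * B + 9)) s' \<and>
    s' 1 = [r \<and> unary_ge c bs]"
  using assms
proof (induction bs arbitrary: s c r)
  case Nil
  then have "runs f (While (Nonempty 0) compare_bit) s 1 s" by (intro runs_While_done) simp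
  then show ?case using Nil by auto
next
  case (Cons b bs)
  let ?s = "s(0 := bs, 12 := replicate ((c - of_bool b) div 2) True, 1 := [r \<and> \<not> (b \<and> c = 0)])"
  have "(c - of_bool b) div 2 \<le> B" using Cons.prems(6) by (simp add: le_trans[OF div_le_dividend] le_trans[OF diff_le_self])
  then have "\<exists>s'. runs f (While (Nonempty 0) compare_bit) ?s (1 + length bs * (6 * B + 9)) s' \<and>
      s' 1 = [(r \<and> \<not> (b \<and> c = 0)) \<and> unary_ge ((c - of_bool b) div 2) bs]"
    by (intro Cons.IH) (use Cons.prems in auto)
  then obtain s' where s': "runs f (While (Nonempty 0) compare_bit) ?s (1 + length bs * (6 * B + 9)) s'"
      "s' 1 = [(r \<and> \<not> (b \<and> c = 0)) \<and> unary_ge ((c - of_bool b) div 2) bs]" by blast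
  have "runs f (While (Nonempty 0) compare_bit) s (1 + length (b # bs) * (6 * B + 9)) s'"
    by (rule runs_weaken[OF runs_While_step[OF _ runs_compare_bit[OF Cons.prems] s'(1)]])
      (use Cons.prems in auto)
  then show ?case using s'(2) by (intro exI[of _ s']) auto
qed

text \<open>Every cut meets a negative threshold, so a set sign bit leaves the initial YES in
  place.\<close>

definition decide :: com where
  "decide = Seq (Push 1 True) (Cond (Top 0) Skip (Seq (Pop 0) (While (Nonempty 0) compare_bit)))"

lemma runs_decide:
  assumes "s 0 = enc_int k" "length (s 0) \<le> B" "s 12 = replicate c True" "c \<le> B"
    and "s 1 = []" "s 13 = []" "s 14 = []"
  shows "\<exists>s'. runs f decide s (4 + B * (6 * B + 9)) s' \<and> s' 1 = [k \<le> int c]"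
proof -
  let ?s = "s(1 := [True])"
  have push: "runs f (Push 1 True) s 1 ?s"
    by (rule runs_weaken[OF runs_Push]) (use assms(5) in \<open>auto simp: fun_eq_iff\<close>)
  show ?thesis
  proof (cases "k < 0")
    case True
    have "runs f (Cond (Top 0) Skip (Seq (Pop 0) (While (Nonempty 0) compare_bit))) ?s (1 + 1) ?s"
      by (rule runs_Cond) (use True assms(1) in \<open>auto simp: enc_int_def intro!: runs_Skip[simplified]\<close>)
    from runs_Seq[OF push this] have "runs f decide s (4 + B * (6 * B + 9)) ?s"
      unfolding decide_def by (rule runs_weaken) auto
    then show ?thesis using True by (intro exI[of _ ?s]) auto
  next
    case False
    let ?bs = "enc_nat (nat k)" and ?t = "?s(0 := enc_nat (nat k))"
    have s0: "s 0 = False # ?bs" using False assms(1) by (simp add: enc_int_def)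
    obtain s' where s': "runs f (While (Nonempty 0) compare_bit) ?t (1 + length ?bs * (6 * B + 9)) s'"
        "s' 1 = [True \<and> unary_ge c ?bs]"
      using runs_compare_loop[of ?t ?bs c True B f] assms by auto
    have "runs f (Pop 0) ?s 1 ?t" by (rule runs_weaken[OF runs_Pop]) (auto simp: s0)
    from runs_Seq[OF this s'(1)]
    have "runs f (Cond (Top 0) Skip (Seq (Pop 0) (While (Nonempty 0) compare_bit))) ?s
        (1 + (1 + (1 + length ?bs * (6 * B + 9)))) s'"
      by (intro runs_Cond) (auto simp: s0)
    from runs_Seq[OF push this] have "runs f decide s (4 + B * (6 * B + 9)) s'"
      unfolding decide_def
      by (rule runs_weaken) (use assms(2) s0 in \<open>auto intro: mult_le_mono1\<close>)
    then show ?thesis using s'(2) False by (intro exI[of _ s']) (auto simp: unary_ge_enc_nat)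
  qed
qed

section \<open>Assembly and correctness of the program\<close>

definition build_query :: com where
  "build_query = Seq emit_header (Seq emit_graph_rows
    (Seq (emit_block_rows False True) (Seq (emit_block_rows True False) reverse)))"

lemma length_concat_map_upt:
  "(\<And>i. i < k \<Longrightarrow> length (g i) = l) \<Longrightarrow> length (concat (map g [0..<k])) = k * l"
  by (induction k) auto

lemma length_enc_weighted_graph: "length (enc_weighted_graph n E w) = n + 1 + n * (2 * n)"
  by (simp add: enc_weighted_graph_def length_concat_map_upt[where l = 2]
      length_concat_map_upt[where l = "n * 2"])

lemma length_enc_graph: "length (enc_graph n E) = n + 1 + n * n"
  by (simp add: enc_graph_def length_concat_map_upt[where l = n])

lemma runs_build_query:
  assumes "graph {..<n} E" "length (s 3) = n" "length (s 2) = m" "n \<le> B" "m \<le> B"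
    and "s 5 = []" "s 6 = []" "s 7 = []" "s 8 = []"
    and "s 4 = concat (map (\<lambda>i. map (\<lambda>j. {i, j} \<in> E) [0..<n]) [0..<n]) @ z"
  shows "runs f build_query s (124 * B * B + 48 * B + 16)
    (s(4 := z, 8 := enc_weighted_graph (n + 2 * m) (gadget_edges n m E) (gadget_weight n m)))"
proof -
  define q where "q = enc_weighted_graph (n + 2 * m) (gadget_edges n m E) (gadget_weight n m)"
  have "length q = (n + 2 * m) + 1 + (n + 2 * m) * (2 * (n + 2 * m))"
    unfolding q_def by (rule length_enc_weighted_graph)
  also have "\<dots> \<le> 3 * B + 1 + (3 * B) * (2 * (3 * B))"
    using assms(4,5) by (intro add_mono mult_mono) auto
  finally have len: "length q \<le> 18 * B * B + 3 * B + 1" by simp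
  define h where "h = replicate n True @ concat (replicate m [True, True]) @ [False]"
  define gr where "gr = concat (map (\<lambda>i. concat (map (\<lambda>j. [{i, j} \<in> E, {i, j} \<in> E]) [0..<n]) @
      concat (replicate m [True, False, True, False])) [0..<n])"
  define b1 where "b1 = concat (replicate m (concat (replicate n [True, False]) @
      concat (replicate m [False, False]) @ concat (replicate m [True, True])))"
  define b2 where "b2 = concat (replicate m (concat (replicate n [True, False]) @
      concat (replicate m [True, True]) @ concat (replicate m [False, False])))"
  have q: "q = h @ gr @ b1 @ b2"
    unfolding q_def h_def gr_def b1_def b2_def using enc_weighted_gadget[OF assms(1), of m] by simp
  have 1: "runs f emit_header s (11 * B + 5) (s(5 := rev h))"
    using runs_emit_header[of s n m B f] assms by (simp add: h_def)
  have 2: "runs f emit_graph_rows (s(5 := rev h)) (2 + B + B * ((16 * B + 4) + 2))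
      (s(4 := z, 5 := rev (h @ gr)))"
    by (rule runs_weaken[OF runs_emit_graph_rows[of _ n m B "\<lambda>i j. {i, j} \<in> E" z]])
      (use assms in \<open>simp_all add: gr_def fun_eq_iff\<close>)
  have 3: "runs f (emit_block_rows False True) (s(4 := z, 5 := rev (h @ gr)))
      (2 + B + B * ((18 * B + 6) + 2)) (s(4 := z, 5 := rev (h @ gr @ b1)))"
    by (rule runs_weaken[OF runs_emit_block_rows[of _ n m B]])
      (use assms in \<open>simp_all add: b1_def fun_eq_iff\<close>)
  have 4: "runs f (emit_block_rows True False) (s(4 := z, 5 := rev (h @ gr @ b1)))
      (2 + B + B * ((18 * B + 6) + 2)) (s(4 := z, 5 := rev q))"
    by (rule runs_weaken[OF runs_emit_block_rows[of _ n m B]])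
      (use assms in \<open>simp_all add: b2_def q fun_eq_iff\<close>)
  have 5: "runs f reverse (s(4 := z, 5 := rev q)) (1 + length q * 4) (s(4 := z, 8 := q))"
    by (rule runs_weaken[OF runs_reverse]) (use assms in \<open>auto simp: fun_eq_iff\<close>)
  show ?thesis
    unfolding build_query_def q_def[symmetric]
    by (rule runs_weaken[OF runs_Seq[OF 1 runs_Seq[OF 2 runs_Seq[OF 3 runs_Seq[OF 4 5]]]]])
      (use len in \<open>simp_all add: algebra_simps\<close>)
qed

definition max_cut_program :: com where
  "max_cut_program = Seq parse (Seq build_query (Seq (Query 8 9) (Seq count_cut decide)))"

text \<open>Identifies the final content of the unary counter: the double sum counts ordered pairs,
  which \<open>card_cut_eq\<close> matches with the cut edges.\<close>

lemma cut_count_eq: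
  fixes n :: nat
  assumes "graph {..<n} E"
  shows "(\<Sum>i<n. \<Sum>j<n. of_bool ({i, j} \<in> E \<and> i \<in> A \<and> j \<notin> A)) = card (cut E A)"
proof -
  have "(\<Sum>i<n. \<Sum>j<n. of_bool ({i, j} \<in> E \<and> i \<in> A \<and> j \<notin> A) :: nat)
      = (\<Sum>p\<in>{..<n} \<times> {..<n}. of_bool ({fst p, snd p} \<in> E \<and> fst p \<in> A \<and> snd p \<notin> A))"
    by (simp only: sum.cartesian_product split_def)
  also have "\<dots> = card {p \<in> {..<n} \<times> {..<n}. {fst p, snd p} \<in> E \<and> fst p \<in> A \<and> snd p \<notin> A}"
    unfolding card_eq_sum of_bool_def by (rule sum.inter_filter[symmetric]) simp
  also have "{p \<in> {..<n} \<times> {..<n}. {fst p, snd p} \<in> E \<and> fst p \<in> A \<and> snd p \<notin> A}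
      = {(x, y) \<in> ({..<n} \<inter> A) \<times> ({..<n} - A). {x, y} \<in> E}" by auto
  finally show ?thesis by (simp add: card_cut_eq[OF assms])
qed

lemma max_cut_program_correct:
  assumes f: "oracle_for MaxAvgCutOpt f" and G: "connected_graph {..<n} E"
    and x: "x = enc_graph n E @ enc_int k" and L: "L = length x"
  shows "\<exists>s. runs f max_cut_program (input_state x) (160 * L * L + 100 * L + 100) s \<and>
    result s = [\<exists>A B. vertex_partition {..<n} A B \<and> k \<le> int (card (cut E A))]"
proof -
  have graph: "graph {..<n} E" and n: "0 < n"
    using G unfolding connected_graph_def by (auto simp: lessThan_empty_iff)
  define adj where "adj = concat (map (\<lambda>i. map (\<lambda>j. {i, j} \<in> E) [0..<n]) [0..<n])"
  define z where "z = adj @ enc_int k"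
  have xz: "x = replicate n True @ False # z" by (simp add: x enc_graph_def adj_def z_def)
  have Leq: "L = n + 1 + n * n + length (enc_int k)"
    using length_enc_graph[of n E] by (simp add: L x)
  then have bounds: "n \<le> L" "n * n \<le> L" "length (enc_int k) \<le> L" "n < L" "n * n < 2 * L" by simp_all
  \<comment> \<open>The input contains an \<open>n\<close> by \<open>n\<close> matrix and a unary
    \<open>n\<close>, so its length satisfies both size conditions on \<open>m\<close>; no
    multiplication has to be programmed.\<close>
  define m where "m = L"
  define q where "q = enc_weighted_graph (n + 2 * m) (gadget_edges n m E) (gadget_weight n m)"
  have con: "connected_graph {..<n + 2 * m} (gadget_edges n m E)"
    by (rule connected_gadget) (use graph n bounds m_def in auto)
  have w: "\<forall>e\<in>gadget_edges n m E. gadget_weight n m e \<in> {-1, 1}" by (auto simp: gadget_weight_def)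
  \<comment> \<open>The oracle is constrained only on instances that have a correct output, so
    solvability of the query comes first.\<close>
  have "\<exists>y. MaxAvgCutOpt q y"
    unfolding q_def by (rule MaxAvgCutOpt_solvable[OF con w]) (use bounds n m_def in auto)
  with f have "MaxAvgCutOpt q (f q)" unfolding oracle_for_def by blast
  then obtain n' E' w' A B where o: "connected_graph {..<n'} E'" "\<forall>e\<in>E'. w' e \<in> {-1, 1}"
      "q = enc_weighted_graph n' E' w'" "f q = enc_partition n' A B" "nontrivial_partition {..<n'} A B"
      "\<forall>A' B'. nontrivial_partition {..<n'} A' B' \<longrightarrow> avg_cut E' w' A' \<le> avg_cut E' w' A"
    unfolding MaxAvgCutOpt_def by blast
  \<comment> \<open>The oracle's guarantee concerns some graph encoded by \<open>q\<close>;
    injectivity identifies it with the gadget. The weights agree only on edges, which is enough for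
    averages over cuts.\<close>
  have same: "n + 2 * m = n' \<and> gadget_edges n m E = E' \<and> (\<forall>e\<in>gadget_edges n m E. gadget_weight n m e = w' e)"
    by (rule enc_weighted_graph_inj)
      (use con o(1,2,3) w in \<open>auto simp: q_def connected_graph_def\<close>)
  have avg: "avg_cut E' w' C = avg_cut (gadget_edges n m E) (gadget_weight n m) C" for C
  proof -
    have "(\<Sum>e\<in>cut E' C. w' e) = (\<Sum>e\<in>cut E' C. gadget_weight n m e)"
      by (rule sum.cong) (use same in \<open>auto simp: cut_def\<close>)
    then show ?thesis using same by (simp add: avg_cut_def)
  qed
  have opt: "card (cut E D) \<le> card (cut E A)" if "D \<subseteq> {..<n}" for D
    by (rule gadget_optimal_max_cut[OF graph n _ _ _ _ that, of m A B])
      (use bounds m_def o(5,6) same avg in auto)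
  let ?c = "card (cut E A)"
  \<comment> \<open>One direction is maximality of the trace of \<open>A\<close>; for the other that
    trace is itself the witness.\<close>
  have answer: "(\<exists>A B. vertex_partition {..<n} A B \<and> k \<le> int (card (cut E A))) \<longleftrightarrow> k \<le> int ?c"
  proof
    assume "\<exists>A B. vertex_partition {..<n} A B \<and> k \<le> int (card (cut E A))"
    then obtain D where "D \<subseteq> {..<n}" "k \<le> int (card (cut E D))"
      unfolding vertex_partition_def by blast
    then show "k \<le> int ?c" using opt[of D] by linarith
  next
    assume k: "k \<le> int ?c"
    have "vertex_partition {..<n} ({..<n} \<inter> A) ({..<n} - A)" unfolding vertex_partition_def by blast
    with k cut_Int_vertices[OF graph, of A]
    show "\<exists>A B. vertex_partition {..<n} A B \<and> k \<le> int (card (cut E A))" by metis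
  qed
  \<comment> \<open>The time for comparing and halving depends on the unary count, so it too needs a
    bound in \<open>L\<close>.\<close>
  have c: "?c \<le> L"
  proof -
    have "?c \<le> card ({..<n} \<inter> A) * (n - card ({..<n} \<inter> A))" using card_cut_le[OF graph, of A] by simp
    also have "\<dots> \<le> n * n" using card_mono[of "{..<n}" "{..<n} \<inter> A"] by (intro mult_le_mono) auto
    finally show ?thesis using bounds by linarith
  qed
  \<comment> \<open>Splits the answer into the bits of the original vertices and those of the added
    ones, the form \<open>runs_count_cut\<close> expects.\<close>
  have fq: "f q = map (\<lambda>i. i \<in> A) [0..<n] @ map (\<lambda>i. i \<in> A) [n..<n + 2 * m]"
  proof -
    have "n' = n + 2 * m" using same by simp
    then show ?thesis
      by (simp only: o(4) enc_partition_def map_append[symmetric] upt_add_eq_append[OF zero_le, symmetric])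
  qed
  have lenf: "length (f q) \<le> 3 * L" using bounds by (simp add: fq m_def)
  have "length q = (n + 2 * m) + 1 + (n + 2 * m) * (2 * (n + 2 * m))"
    unfolding q_def by (rule length_enc_weighted_graph)
  also have "\<dots> \<le> 3 * L + 1 + (3 * L) * (2 * (3 * L))"
    using bounds m_def by (intro add_mono mult_mono) auto
  finally have lenq: "length q \<le> 18 * L * L + 3 * L + 1" by simp

  let ?s0 = "input_state x"
  let ?s1 = "?s0(2 := x, 0 := z, 3 := replicate n True, 4 := z)"
  let ?s2 = "?s1(4 := enc_int k, 8 := q)"
  let ?s3 = "?s2(9 := f q)"
  have 1: "runs f parse ?s0 (5 * L + 5) ?s1"
    using runs_parse[of ?s0 n z L f] xz L by (simp add: input_state_def)
  have 2: "runs f build_query ?s1 (124 * L * L + 48 * L + 16) ?s2"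
    unfolding q_def
    by (rule runs_build_query[OF graph])
      (use bounds in \<open>simp_all add: input_state_def m_def L z_def adj_def\<close>)
  have 3: "runs f (Query 8 9) ?s2 (1 + length q + length (f q)) ?s3"
    by (rule runs_weaken[OF runs_Query]) auto
  obtain s4 where 4: "runs f count_cut ?s3 (3 + 3 * L + L + L * (9 * L + 3 * L + 6)) s4"
      "s4 0 = enc_int k" "s4 12 = replicate ?c True" "s4 1 = []" "s4 13 = []" "s4 14 = []"
    using runs_count_cut[of ?s3 n L "3 * L" "\<lambda>i j. {i, j} \<in> E" "enc_int k" "\<lambda>i. i \<in> A"
        "map (\<lambda>i. i \<in> A) [n..<n + 2 * m]" f] bounds lenf fq cut_count_eq[OF graph, of A]
    by (auto simp: input_state_def z_def adj_def)
  obtain s5 where 5: "runs f decide s4 (4 + L * (6 * L + 9)) s5" "s5 1 = [k \<le> int ?c]"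
    using runs_decide[OF 4(2) _ 4(3) c 4(4,5,6)] 4(2) bounds by auto
  have "runs f max_cut_program ?s0 (160 * L * L + 100 * L + 100) s5"
    unfolding max_cut_program_def
    by (rule runs_weaken[OF runs_Seq[OF 1 runs_Seq[OF 2 runs_Seq[OF 3 runs_Seq[OF 4(1) 5(1)]]]]])
      (use lenq lenf in \<open>simp_all add: algebra_simps\<close>)
  then show ?thesis using 5(2) answer by (auto simp: result_def)
qed

theorem theorem2:
  shows "poly_time_turing_reducible MaxCut MaxAvgCutOpt"
  unfolding poly_time_turing_reducible_def
\<comment> \<open>The coefficients are listed from the constant term upwards, so the quadratic term
  has coefficient 160.\<close>
proof (rule exI[of _ max_cut_program], rule exI[of _ "[:100, 100, 160:]"], intro allI impI)
  fix f x
  assume f: "oracle_for MaxAvgCutOpt f" and "\<exists>y. MaxCut x y"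
  then obtain n E k where G: "connected_graph {..<n} E" "x = enc_graph n E @ enc_int k"
    unfolding MaxCut_def by blast
  from max_cut_program_correct[OF f G refl] obtain s t
    where "exec f max_cut_program (input_state x) t s"
      and t: "t \<le> 160 * length x * length x + 100 * length x + 100"
      and res: "result s = [\<exists>A B. vertex_partition {..<n} A B \<and> k \<le> int (card (cut E A))]"
    unfolding runs_def by blast
  moreover have "t \<le> poly [:100, 100, 160:] (length x)" using t by (simp add: algebra_simps)
  moreover have "MaxCut x (result s)" unfolding MaxCut_def using G res by blast
  ultimately show "\<exists>t s. exec f max_cut_program (input_state x) t s \<and>
      t \<le> poly [:100, 100, 160:] (length x) \<and> MaxCut x (result s)" by blast
qed

end
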